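(* Let $\Omega\subset\mathbb{R}^{2n}$ be a bounded uniformly convex open set with smooth boundary. For every extendable path $\psi=\{\psi^t\}_{t\in[0,1]}$ of diffeomorphisms of $\partial\Omega$ and every positive path $\phi$ in $\mathrm{Symp}_0(\overline\Omega)$ extending $\psi$, we have $\mathrm{length}_{\mathcal G}(\phi)\le\mathcal{V}(\psi)$. Equality holds if and only if $\phi$ is generated by a uniformly convex Hamiltonian $H$ satisfying the Monge--Amp\`ere equation $\det\nabla^2H_t(z)=c(t)$ for all $(t,z)\in[0,1]\times\overline\Omega$, for some positive numbers $c(t)$.
   Context: $\mathbb{R}^{2n}$ carries $\omega_0=\sum_j\mathrm{d}x_j\wedge\mathrm{d}y_j$ and $J_0$ with $\omega_0(u,v)=J_0u\cdot v$. $\mathrm{Symp}_0(\overline\Omega)$ is the identity component of the symplectomorphism group of $\overline\Omega$. A positive path is $\phi=\{\phi^t_H\}_{t\in[0,1]}$ with $\frac{\mathrm{d}}{\mathrm{d}t}\phi^t_H=J_0\nabla H_t(\phi^t_H)$, $\phi^0_H=\mathrm{id}$, where $H\in C^\infty([0,1]\times\overline\Omega)$, each $H_t$ constant on each leaf of the characteristic foliation of $\partial\Omega$ (tangent to $\ker\omega_0|_{T\partial\Omega}$), and $\nabla^2H_t$ positive definite on $\overline\Omega$ (uniformly convex). $\mathrm{length}_{\mathcal G}(\phi)=\frac{1}{\mathrm{vol}(\Omega)}\int_0^1\int_\Omega(\det\nabla^2H_t(z))^{1/(2n)}\,\mathrm{d}z\,\mathrm{d}t$. A smooth path of diffeomorphisms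 $\psi^t$ of $\partial\Omega$ is extendable if $\psi^t=\phi^t|_{\partial\Omega}$ for some positive path $\phi$ (then $\phi$ extends $\psi$). For such $\psi$, $\mathcal{V}(\psi)=\mathrm{vol}(\Omega)^{-1/(2n)}\int_0^1\mathrm{vol}(\nabla H_t(\Omega))^{1/(2n)}\,\mathrm{d}t$, where $H$ generates any positive path extending $\psi$ (the sets $\nabla H_t(\Omega)$ depend only on $\psi$). *)

theory Defs
  imports "HOL-Analysis.Analysis"
begin

text \<open>Ambient space: R^(2n) is modelled as real^('n + 'n); the coordinate
  indexed by Inl j is x_j and the one indexed by Inr j is y_j.\<close>

definition omega0 :: "real^('n::finite + 'n) \<Rightarrow> real^('n + 'n) \<Rightarrow> real" where
  "omega0 u v = (\<Sum>j\<in>UNIV. u $ Inl j * v $ Inr j - u $ Inr j * v $ Inl j)"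

definition J0 :: "real^('n::finite + 'n) \<Rightarrow> real^('n + 'n)" where
  "J0 u = (\<chi> i. case i of Inl j \<Rightarrow> - u $ Inr j | Inr j \<Rightarrow> u $ Inl j)"

fun Ck_on :: "nat \<Rightarrow> 'a::real_normed_vector set \<Rightarrow> ('a \<Rightarrow> 'b::real_normed_vector) \<Rightarrow> bool" where
  "Ck_on 0 U f = continuous_on U f"
| "Ck_on (Suc k) U f =
     (\<exists>f'. (\<forall>x\<in>U. (f has_derivative f' x) (at x)) \<and> (\<forall>v. Ck_on k U (\<lambda>x. f' x v)))"

definition smooth_on :: "'a::real_normed_vector set \<Rightarrow> ('a \<Rightarrow> 'b::real_normed_vector) \<Rightarrow> bool" where
  "smooth_on U f \<longleftrightarrow> (\<forall>k. Ck_on k U f)"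

definition grad :: "(real^'m::finite \<Rightarrow> real) \<Rightarrow> real^'m \<Rightarrow> real^'m" where
  "grad f z = (\<chi> i. frechet_derivative f (at z) (axis i 1))"

definition hess :: "(real^'m::finite \<Rightarrow> real) \<Rightarrow> real^'m \<Rightarrow> real^'m^'m" where
  "hess f z = matrix (frechet_derivative (grad f) (at z))"

definition pos_def :: "real^'m::finite^'m \<Rightarrow> bool" where
  "pos_def A \<longleftrightarrow> (\<forall>v. v \<noteq> 0 \<longrightarrow> v \<bullet> (A *v v) > 0)"

definition unif_convex_domain :: "(real^'m::finite) set \<Rightarrow> bool" where
  "unif_convex_domain \<Omega> \<longleftrightarrow> open \<Omega> \<and> bounded \<Omega> \<and> convex \<Omega> \<and>
     (\<forall>p\<in>frontier \<Omega>. \<exists>U \<rho>. open U \<and> p \<in> U \<and> smooth_on U \<rho> \<and>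
        (\<forall>x\<in>U. x \<in> \<Omega> \<longleftrightarrow> \<rho> x < 0) \<and> (\<forall>x\<in>U. grad \<rho> x \<noteq> 0) \<and>
        (\<forall>v. v \<noteq> 0 \<and> v \<bullet> grad \<rho> p = 0 \<longrightarrow> v \<bullet> (hess \<rho> p *v v) > 0))"

definition tangent_space :: "'a::real_normed_vector set \<Rightarrow> 'a \<Rightarrow> 'a set" where
  "tangent_space S p = {v. \<exists>\<gamma> e. e > 0 \<and> (\<forall>s\<in>{-e<..<e}. \<gamma> s \<in> S) \<and> \<gamma> 0 = p \<and>
                           (\<gamma> has_vector_derivative v) (at 0)}"

definition char_kernel :: "(real^('n::finite + 'n)) set \<Rightarrow> real^('n + 'n) \<Rightarrow> (real^('n + 'n)) set" where
  "char_kernel S p = {v \<in> tangent_space S p. \<forall>w \<in> tangent_space S p. omega0 v w = 0}"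

definition const_on_char_leaves :: "(real^('n::finite + 'n)) set \<Rightarrow> (real^('n + 'n) \<Rightarrow> real) \<Rightarrow> bool" where
  "const_on_char_leaves \<Omega> h \<longleftrightarrow>
     (\<forall>\<gamma> a b. a \<le> b \<and> (\<forall>s\<in>{a..b}. \<gamma> s \<in> frontier \<Omega> \<and>
        (\<exists>v. (\<gamma> has_vector_derivative v) (at s within {a..b}) \<and> v \<in> char_kernel (frontier \<Omega>) (\<gamma> s)))
      \<longrightarrow> h (\<gamma> a) = h (\<gamma> b))"

definition positive_path :: "(real^('n::finite + 'n)) set \<Rightarrow> (real \<Rightarrow> real^('n + 'n) \<Rightarrow> real^('n + 'n))
     \<Rightarrow> (real \<Rightarrow> real^('n + 'n) \<Rightarrow> real) \<Rightarrow> bool" where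
  "positive_path \<Omega> \<phi> H \<longleftrightarrow>
     (\<exists>W. open W \<and> {0..1} \<times> closure \<Omega> \<subseteq> W \<and> smooth_on W (\<lambda>(t, z). H t z)) \<and>
     (\<forall>t\<in>{0..1}. const_on_char_leaves \<Omega> (H t)) \<and>
     (\<forall>t\<in>{0..1}. \<forall>z\<in>closure \<Omega>. pos_def (hess (H t) z)) \<and>
     (\<forall>z\<in>closure \<Omega>. \<phi> 0 z = z) \<and>
     (\<forall>t\<in>{0..1}. \<forall>z\<in>closure \<Omega>.
        ((\<lambda>s. \<phi> s z) has_vector_derivative J0 (grad (H t) (\<phi> t z))) (at t within {0..1}))"

definition extends_path :: "(real^('n::finite + 'n)) set \<Rightarrow> (real \<Rightarrow> real^('n + 'n) \<Rightarrow> real^('n + 'n))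
     \<Rightarrow> (real \<Rightarrow> real^('n + 'n) \<Rightarrow> real^('n + 'n)) \<Rightarrow> bool" where
  "extends_path \<Omega> \<phi> \<psi> \<longleftrightarrow> (\<forall>t\<in>{0..1}. \<forall>z\<in>frontier \<Omega>. \<phi> t z = \<psi> t z)"

definition extendable :: "(real^('n::finite + 'n)) set \<Rightarrow> (real \<Rightarrow> real^('n + 'n) \<Rightarrow> real^('n + 'n)) \<Rightarrow> bool" where
  "extendable \<Omega> \<psi> \<longleftrightarrow> (\<exists>\<phi> H. positive_path \<Omega> \<phi> H \<and> extends_path \<Omega> \<phi> \<psi>)"

definition lengthG :: "(real^('n::finite + 'n)) set \<Rightarrow> (real \<Rightarrow> real^('n + 'n) \<Rightarrow> real^('n + 'n)) \<Rightarrow> real" where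
  "lengthG \<Omega> \<phi> = (let H = (SOME H. positive_path \<Omega> \<phi> H) in
     (1 / measure lebesgue \<Omega>) *
       integral {0..1} (\<lambda>t. integral \<Omega> (\<lambda>z. det (hess (H t) z) powr (1 / real CARD('n + 'n)))))"

definition volV :: "(real^('n::finite + 'n)) set \<Rightarrow> (real \<Rightarrow> real^('n + 'n) \<Rightarrow> real^('n + 'n)) \<Rightarrow> real" where
  "volV \<Omega> \<psi> = (let H = (SOME H. \<exists>\<phi>. positive_path \<Omega> \<phi> H \<and> extends_path \<Omega> \<phi> \<psi>) in
     measure lebesgue \<Omega> powr (- 1 / real CARD('n + 'n)) *
       integral {0..1} (\<lambda>t. measure lebesgue (grad (H t) ` \<Omega>) powr (1 / real CARD('n + 'n))))"

end

theory Submission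
  imports Defs
begin

text \<open>
  A Hamiltonian that is constant on the characteristic leaves generates a vector field tangent to the
  boundary, with normal component \<open>O(\<bar>\<rho>\<bar>)\<close> for a defining function \<open>\<rho>\<close>; hence the flow preserves the
  interior and the boundary, and, being homotopic to the identity through boundary-preserving maps, it is
  onto. So the path determines \<open>\<nabla>H\<^sub>t\<close> on the closure, and its boundary values determine \<open>\<nabla>H\<^sub>t\<close> on the
  boundary. By convexity the latter determines the gradient image: \<open>y\<close> is missed iff \<open>H\<^sub>t - y \<bullet> z\<close> is
  minimal at a boundary point. The volume of the gradient image is \<open>\<integral> det \<nabla>\<^sup>2H\<^sub>t\<close>, and Jensen's inequality
  for the power \<open>1 / 2n\<close>, with its equality case, gives the comparison at each time.
\<close>

section \<open>Change of variables for arbitrary finite index types\<close>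

definition reindex_cart :: "('b \<Rightarrow> 'a) \<Rightarrow> 'c^'a::finite \<Rightarrow> 'c^'b::finite" where
  "reindex_cart e x = (\<chi> i. x $ e i)"

lemma reindex_cart_nth [simp]: "reindex_cart e x $ i = x $ e i"
  by (simp add: reindex_cart_def)

lemma reindex_cart_inv [simp]:
  assumes "bij e"
  shows "reindex_cart e (reindex_cart (inv e) x) = x" "reindex_cart (inv e) (reindex_cart e y) = y"
  using assms by (simp_all add: vec_eq_iff bij_is_inj bij_is_surj surj_f_inv_f)

lemma inj_reindex_cart: "bij e \<Longrightarrow> inj (reindex_cart e)"
  by (metis injI reindex_cart_inv(2))

lemma reindex_cart_image_eq_vimage:
  assumes "bij e"
  shows "reindex_cart e ` S = reindex_cart (inv e) -` S"
  using assms by (auto simp: image_iff) (metis reindex_cart_inv(1))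

lemma bounded_linear_reindex_cart:
  "bounded_linear (reindex_cart e :: real^'a::finite \<Rightarrow> real^'b::finite)"
  unfolding linear_conv_bounded_linear[symmetric] by (rule linearI) (simp_all add: vec_eq_iff)

lemma norm_reindex_cart:
  fixes e :: "'b::finite \<Rightarrow> 'a::finite" and x :: "real^'a"
  assumes "bij e"
  shows "norm (reindex_cart e x) = norm x"
  using sum.reindex_bij_betw[OF assms, of "\<lambda>i. (x $ i)\<^sup>2"] by (simp add: norm_vec_def L2_set_def)

lemma reindex_cart_image_cbox:
  fixes e :: "'b::finite \<Rightarrow> 'a::finite" and u v :: "real^'a"
  assumes "bij e"
  shows "reindex_cart e ` cbox u v = cbox (reindex_cart e u) (reindex_cart e v)"
  unfolding reindex_cart_image_eq_vimage[OF assms]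
  by (auto simp: mem_box_cart) (metis assms bij_inv_eq_iff)+

lemma content_reindex_cart_image_cbox:
  fixes e :: "'b::finite \<Rightarrow> 'a::finite" and u v :: "real^'a"
  assumes "bij e"
  shows "measure lborel (reindex_cart e ` cbox u v) = measure lborel (cbox u v)"
proof (cases "cbox u v = {}")
  case False
  then have "cbox (reindex_cart e u) (reindex_cart e v) \<noteq> {}"
    using reindex_cart_image_cbox[OF assms, of u v] by auto
  with False show ?thesis
    using prod.reindex_bij_betw[OF assms, of "\<lambda>i. v $ i - u $ i"]
    by (simp add: reindex_cart_image_cbox[OF assms] content_cbox_cart)
qed simp

lemma has_integral_reindex_cart_cbox:
  fixes e :: "'b::finite \<Rightarrow> 'a::finite" and f :: "real^'b \<Rightarrow> 'c::real_normed_vector"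
  assumes e: "bij e" and f: "(f has_integral i) (cbox (reindex_cart e a) (reindex_cart e b))"
  shows "((\<lambda>x. f (reindex_cart e x)) has_integral i) (cbox a b)"
proof -
  note e' = bij_imp_bij_inv[OF e]
  have "((\<lambda>x. f (reindex_cart e x)) has_integral (1 / 1) *\<^sub>R i)
      (reindex_cart (inv e) ` cbox (reindex_cart e a) (reindex_cart e b))"
  proof (rule has_integral_twiddle[OF _ _ _ _ _ _ _ f])
    show "continuous (at x) (reindex_cart e :: real^'a \<Rightarrow> real^'b)" for x
      by (rule linear_continuous_at[OF bounded_linear_reindex_cart])
    show "\<exists>w z. (reindex_cart e ` cbox u v :: (real^'b) set) = cbox w z" for u v
      using reindex_cart_image_cbox[OF e] by blast
    show "\<exists>w z. (reindex_cart (inv e) ` cbox u v :: (real^'a) set) = cbox w z" for u v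
      using reindex_cart_image_cbox[OF e'] by blast
    show "measure lborel (reindex_cart e ` cbox u v :: (real^'b) set) = 1 * measure lborel (cbox u v)" for u v
      by (simp add: content_reindex_cart_image_cbox[OF e])
  qed (use e in auto)
  then show ?thesis
    using e e' by (simp add: reindex_cart_image_cbox)
qed

lemma has_integral_reindex_cart:
  fixes e :: "'b::finite \<Rightarrow> 'a::finite" and f :: "real^'b \<Rightarrow> 'c::banach"
  assumes e: "bij e" and f: "(f has_integral i) UNIV"
  shows "((\<lambda>x. f (reindex_cart e x)) has_integral i) UNIV"
  unfolding has_integral'[of _ _ UNIV] if_P[OF UNIV_I]
proof (intro allI impI)
  fix r :: real assume "r > 0"
  then obtain B where "B > 0" and approx: "\<And>a b. ball 0 B \<subseteq> cbox a b \<Longrightarrow>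
      \<exists>z. (f has_integral z) (cbox a b) \<and> norm (z - i) < r"
    using f unfolding has_integral'[of _ _ UNIV] if_P[OF UNIV_I] by blast
  have "\<exists>z. ((\<lambda>x. f (reindex_cart e x)) has_integral z) (cbox a b) \<and> norm (z - i) < r"
    if "ball 0 B \<subseteq> cbox a b" for a b :: "real^'a"
  proof -
    have "reindex_cart (inv e) y \<in> cbox a b" if "y \<in> ball 0 B" for y :: "real^'b"
    proof -
      have "reindex_cart (inv e) y \<in> ball 0 B"
        using that by (simp add: norm_reindex_cart[OF bij_imp_bij_inv[OF e]])
      with \<open>ball 0 B \<subseteq> cbox a b\<close> show ?thesis by blast
    qed
    then have "ball 0 B \<subseteq> cbox (reindex_cart e a) (reindex_cart e b)"
      unfolding reindex_cart_image_cbox[OF e, symmetric] reindex_cart_image_eq_vimage[OF e] by blast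
    from approx[OF this] show ?thesis
      by (blast intro: has_integral_reindex_cart_cbox[OF e])
  qed
  with \<open>B > 0\<close> show "\<exists>B>0. \<forall>a b. ball 0 B \<subseteq> cbox a b \<longrightarrow>
      (\<exists>z. ((\<lambda>x. f (reindex_cart e x)) has_integral z) (cbox a b) \<and> norm (z - i) < r)"
    by blast
qed

lemma has_integral_reindex_cart_image_iff:
  fixes e :: "'b::finite \<Rightarrow> 'a::finite" and f :: "real^'b \<Rightarrow> 'c::banach"
  assumes e: "bij e"
  shows "(f has_integral i) (reindex_cart e ` S) \<longleftrightarrow> ((\<lambda>x. f (reindex_cart e x)) has_integral i) S"
proof -
  define f_on_image where "f_on_image = (\<lambda>y. if y \<in> reindex_cart e ` S then f y else 0)"
  have "(f_on_image has_integral i) UNIV"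
    if "((\<lambda>x. f_on_image (reindex_cart e x)) has_integral i) UNIV"
    using has_integral_reindex_cart[OF bij_imp_bij_inv[OF e] that] e by simp
  then have "(f_on_image has_integral i) UNIV \<longleftrightarrow> ((\<lambda>x. f_on_image (reindex_cart e x)) has_integral i) UNIV"
    using has_integral_reindex_cart[OF e] by blast
  then show ?thesis
    by (simp add: f_on_image_def has_integral_restrict_UNIV inj_image_mem_iff[OF inj_reindex_cart[OF e]])
qed

lemma lmeasurable_reindex_cart_image_iff:
  fixes S :: "(real^'a::finite) set" and e :: "'b::finite \<Rightarrow> 'a"
  assumes "bij e"
  shows "reindex_cart e ` S \<in> lmeasurable \<longleftrightarrow> S \<in> lmeasurable"
  unfolding lmeasurable_iff_integrable_on integrable_on_def
  using has_integral_reindex_cart_image_iff[OF assms, of "\<lambda>_. 1::real"] by simp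

lemma measure_reindex_cart_image:
  fixes S :: "(real^'a::finite) set" and e :: "'b::finite \<Rightarrow> 'a"
  assumes "bij e" "S \<in> lmeasurable"
  shows "measure lebesgue (reindex_cart e ` S) = measure lebesgue S"
proof -
  have "((\<lambda>_. 1::real) has_integral measure lebesgue S) S"
    using assms(2) by (simp add: has_integral_iff lmeasure_integral lmeasurable_iff_integrable_on)
  then have "((\<lambda>_. 1::real) has_integral measure lebesgue S) (reindex_cart e ` S)"
    by (simp add: has_integral_reindex_cart_image_iff[OF assms(1)])
  then show ?thesis
    using assms by (simp add: lmeasure_integral lmeasurable_reindex_cart_image_iff integral_unique)
qed

lemma det_reindex:
  fixes e :: "'b::finite \<Rightarrow> 'a::finite" and A :: "'c::comm_ring_1^'a^'a"
  assumes e: "bij e"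
  shows "det (\<chi> i j. A $ e i $ e j) = det A"
proof -
  let ?conj = "map_permutation UNIV e"
  have inj_e: "inj e" and range_e: "range e = UNIV"
    using e by (simp_all add: bij_is_inj bij_is_surj)
  have "?conj = (\<lambda>p i. if i \<in> UNIV then e (p (inv e i)) else i)"
    by (simp add: map_permutation_def restrict_id_def range_e fun_eq_iff)
  then have bij_conj: "bij_betw ?conj {p. p permutes UNIV} {p. p permutes UNIV}"
    using bij_betw_permutations[OF e] by simp
  have "det A = (\<Sum>p | p permutes UNIV. of_int (sign (?conj p)) * (\<Prod>i\<in>UNIV. A $ i $ ?conj p i))"
    unfolding det_def by (rule sum.reindex_bij_betw[OF bij_conj, symmetric])
  also have "\<dots> = (\<Sum>p | p permutes UNIV. of_int (sign p) * (\<Prod>i\<in>UNIV. A $ e i $ e (p i)))"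
  proof (rule sum.cong[OF refl])
    fix p :: "'b \<Rightarrow> 'b" assume "p \<in> {p. p permutes UNIV}"
    then have "sign (?conj p) = sign p"
      using inj_e by (intro sign_map_permutation) auto
    moreover have "(\<Prod>i\<in>UNIV. A $ i $ ?conj p i) = (\<Prod>i\<in>UNIV. A $ e i $ ?conj p (e i))"
      by (rule prod.reindex_bij_betw[OF e, symmetric])
    ultimately show "of_int (sign (?conj p)) * (\<Prod>i\<in>UNIV. A $ i $ ?conj p i)
        = of_int (sign p) * (\<Prod>i\<in>UNIV. A $ e i $ e (p i))"
      by (simp add: map_permutation_apply[OF inj_e])
  qed
  finally show ?thesis
    by (simp add: det_def)
qed

lemma det_matrix_reindex_cart_conj:
  fixes e :: "'b::finite \<Rightarrow> 'a::finite" and l :: "real^'a \<Rightarrow> real^'a"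
  assumes e: "bij e"
  shows "det (matrix (\<lambda>v. reindex_cart e (l (reindex_cart (inv e) v)))) = det (matrix l)"
proof -
  have "reindex_cart (inv e) (axis j (1::real)) = axis (e j) 1" for j
    by (simp add: vec_eq_iff axis_def) (metis bij_inv_eq_iff[OF e])
  then have "matrix (\<lambda>v. reindex_cart e (l (reindex_cart (inv e) v))) = (\<chi> i j. matrix l $ e i $ e j)"
    by (simp add: matrix_def vec_eq_iff[of "vec_lambda _"])
  then show ?thesis
    by (simp add: det_reindex[OF e])
qed

text \<open>The change of variables theorem of the library needs a well-ordered index type;
  relabelling the coordinates removes this restriction.\<close>

lemma measure_differentiable_image_eq_reindex:
  fixes e :: "'b::{finite,wellorder} \<Rightarrow> 'a::finite" and f :: "real^'a \<Rightarrow> real^'a"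
  assumes e: "bij e" and S: "open S"
    and der: "\<And>x. x \<in> S \<Longrightarrow> (f has_derivative f' x) (at x)"
    and inj: "inj_on f S"
    and int: "(\<lambda>x. \<bar>det (matrix (f' x))\<bar>) integrable_on S"
  shows "measure lebesgue (f ` S) = integral S (\<lambda>x. \<bar>det (matrix (f' x))\<bar>)"
proof -
  let ?T = "reindex_cart e :: real^'a \<Rightarrow> real^'b::_" and ?T' = "reindex_cart (inv e) :: real^'b::_ \<Rightarrow> real^'a"
  let ?g = "\<lambda>y. ?T (f (?T' y))" and ?g' = "\<lambda>y v. ?T (f' (?T' y) (?T' v))"
  have "open (?T ` S)"
    unfolding reindex_cart_image_eq_vimage[OF e]
    using S by (intro open_vimage linear_continuous_on bounded_linear_reindex_cart)
  then have sets: "?T ` S \<in> sets lebesgue"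
    by (simp add: borel_open sets_completionI_sets)
  have der_g: "(?g has_derivative ?g' y) (at y within ?T ` S)" if "y \<in> ?T ` S" for y
  proof (rule has_derivative_at_withinI, rule bounded_linear.has_derivative[OF bounded_linear_reindex_cart])
    have "?T' y \<in> S"
      using that reindex_cart_image_eq_vimage[OF e] by blast
    then show "((\<lambda>y. f (?T' y)) has_derivative (\<lambda>v. f' (?T' y) (?T' v))) (at y)"
      by (rule has_derivative_compose[OF bounded_linear_imp_has_derivative[OF bounded_linear_reindex_cart] der])
  qed
  have inj_g: "inj_on ?g (?T ` S)"
    using inj e inj_reindex_cart[OF e] by (auto simp: inj_on_def)
  have "det (matrix (?g' y)) = det (matrix (f' (?T' y)))" for y
    by (rule det_matrix_reindex_cart_conj[OF e])
  then have "((\<lambda>y. \<bar>det (matrix (?g' y))\<bar>) has_integral integral S (\<lambda>x. \<bar>det (matrix (f' x))\<bar>)) (?T ` S)"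
    using integrable_integral[OF int] e by (simp add: has_integral_reindex_cart_image_iff[OF e])
  then have "?g ` (?T ` S) \<in> lmeasurable \<and>
      measure lebesgue (?g ` (?T ` S)) = integral S (\<lambda>x. \<bar>det (matrix (f' x))\<bar>)"
    using has_measure_differentiable_image[OF sets der_g inj_g] by blast
  moreover have "?g ` (?T ` S) = ?T ` (f ` S)"
    using e by (simp add: image_image)
  ultimately show ?thesis
    using lmeasurable_reindex_cart_image_iff[OF e, of "f ` S"] measure_reindex_cart_image[OF e, of "f ` S"]
    by simp
qed

section \<open>Smooth functions and their gradients\<close>

lemma Ck_on_cong:
  assumes "open U" "Ck_on k U f" "\<And>x. x \<in> U \<Longrightarrow> f x = g x"
  shows "Ck_on k U g"
proof (cases k)
  case 0
  then show ?thesis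
    using assms by (simp cong: continuous_on_cong)
next
  case (Suc j)
  then obtain f' where "\<And>x. x \<in> U \<Longrightarrow> (f has_derivative f' x) (at x)" "\<And>v. Ck_on j U (\<lambda>x. f' x v)"
    using assms(2) by auto
  moreover from this(1) have "(g has_derivative f' x) (at x)" if "x \<in> U" for x
    by (rule has_derivative_transform_within_open[OF _ assms(1) that assms(3)]) (use that in auto)
  ultimately show ?thesis
    using Suc by auto
qed

lemma smooth_on_frechet_derivative:
  assumes U: "open U" and f: "smooth_on U f"
  shows "\<And>x. x \<in> U \<Longrightarrow> (f has_derivative frechet_derivative f (at x)) (at x)"
    and "smooth_on U (\<lambda>x. frechet_derivative f (at x) v)"
proof -
  have derivative: "\<exists>f'. (\<forall>x\<in>U. (f has_derivative f' x) (at x)) \<and> (\<forall>v. Ck_on k U (\<lambda>x. f' x v))" for k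
    using f unfolding smooth_on_def by (metis Ck_on.simps(2))
  then show "(f has_derivative frechet_derivative f (at x)) (at x)" if "x \<in> U" for x
    using that by (metis frechet_derivative_at)
  show "smooth_on U (\<lambda>x. frechet_derivative f (at x) v)"
    unfolding smooth_on_def
  proof
    fix k
    obtain f' where f': "\<And>x. x \<in> U \<Longrightarrow> (f has_derivative f' x) (at x)" "Ck_on k U (\<lambda>x. f' x v)"
      using derivative by blast
    from f'(2) show "Ck_on k U (\<lambda>x. frechet_derivative f (at x) v)"
      by (rule Ck_on_cong[OF U]) (simp add: frechet_derivative_at[OF f'(1)])
  qed
qed

lemma smooth_on_imp_continuous_on: "smooth_on U f \<Longrightarrow> continuous_on U f"
  unfolding smooth_on_def by (metis Ck_on.simps(1))

lemma Ck_on_subset: "Ck_on k U f \<Longrightarrow> V \<subseteq> U \<Longrightarrow> Ck_on k V f"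
  by (induction k arbitrary: f) (auto intro: continuous_on_subset, meson subsetD)

lemma has_derivative_vec_lambda:
  fixes f :: "'i::finite \<Rightarrow> 'a::real_normed_vector \<Rightarrow> real"
  assumes "\<And>i. (f i has_derivative f' i) (at x)"
  shows "((\<lambda>x. \<chi> i. f i x) has_derivative (\<lambda>v. \<chi> i. f' i v)) (at x)"
  using assms by (subst has_derivative_componentwise_within) (auto simp: Basis_vec_def inner_axis)

lemma smooth_on_vec_lambda:
  fixes f :: "'i::finite \<Rightarrow> 'a::real_normed_vector \<Rightarrow> real"
  assumes "\<And>i. smooth_on U (f i)"
  shows "smooth_on U (\<lambda>x. \<chi> i. f i x)"
proof -
  have "Ck_on k U (\<lambda>x. \<chi> i. f i x)" if "\<And>i. Ck_on k U (f i)" for k and f :: "'i \<Rightarrow> 'a \<Rightarrow> real"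
    using that
  proof (induction k arbitrary: f)
    case 0
    then show ?case by (simp add: continuous_on_vec_lambda)
  next
    case (Suc k)
    then have "\<forall>i. \<exists>f'. (\<forall>x\<in>U. (f i has_derivative f' x) (at x)) \<and> (\<forall>v. Ck_on k U (\<lambda>x. f' x v))"
      by simp
    then obtain f' where "\<And>i x. x \<in> U \<Longrightarrow> (f i has_derivative f' i x) (at x)"
        and "\<And>i v. Ck_on k U (\<lambda>x. f' i x v)"
      by metis
    then show ?case
      using has_derivative_vec_lambda[of f "\<lambda>i. f' i _"] Suc.IH
      by (auto intro!: exI[of _ "\<lambda>x v. \<chi> i. f' i x v"])
  qed
  with assms show ?thesis
    by (simp add: smooth_on_def)
qed

lemma smooth_on_snd:
  fixes f :: "'a::real_normed_vector \<Rightarrow> 'b::real_normed_vector"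
  assumes "smooth_on U f"
  shows "smooth_on (UNIV \<times> U) (\<lambda>(t::'t::real_normed_vector, x). f x)"
proof -
  have "Ck_on k (UNIV \<times> U) (\<lambda>(t::'t, x). f x)" if "Ck_on k U f" for k and f :: "'a \<Rightarrow> 'b"
    using that
  proof (induction k arbitrary: f)
    case 0
    then show ?case
      by (auto simp: case_prod_beta' intro: continuous_on_compose2[OF _ continuous_on_snd])
  next
    case (Suc k)
    then obtain f' where f': "\<And>x. x \<in> U \<Longrightarrow> (f has_derivative f' x) (at x)" "\<And>v. Ck_on k U (\<lambda>x. f' x v)"
      by auto
    have "((\<lambda>p. f (snd p)) has_derivative (\<lambda>v. f' (snd p) (snd v))) (at p)"
      if "snd p \<in> U" for p :: "'t \<times> 'a"
      using has_derivative_compose[OF has_derivative_snd[OF has_derivative_ident] f'(1)[OF that]] .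
    moreover have "Ck_on k (UNIV \<times> U) (\<lambda>p::'t \<times> 'a. f' (snd p) (snd v))" for v :: "'t \<times> 'a"
      using Suc.IH[OF f'(2)] by (simp add: case_prod_beta')
    ultimately show ?case
      by (auto simp: case_prod_beta' intro!: exI[of _ "\<lambda>p v. f' (snd p) (snd v)"])
  qed
  with assms show ?thesis
    by (simp add: smooth_on_def)
qed

lemma has_derivative_slice:
  assumes "((\<lambda>(t, x). f t x) has_derivative f') (at (t, x))"
  shows "(f t has_derivative (\<lambda>v. f' (0, v))) (at x)"
proof -
  have "((\<lambda>x. (t, x)) has_derivative (\<lambda>v. (0, v))) (at x)"
    by (intro has_derivative_Pair has_derivative_const has_derivative_ident)
  from has_derivative_compose[OF this assms] show ?thesis
    by simp
qed

lemma smooth_on_has_derivative_slice: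
  assumes "open W" "smooth_on W (\<lambda>(t, x). f t x)" "(t, x) \<in> W"
  shows "(f t has_derivative (\<lambda>v. frechet_derivative (\<lambda>(t, x). f t x) (at (t, x)) (0, v))) (at x)"
  by (rule has_derivative_slice[OF smooth_on_frechet_derivative(1)[OF assms]])

lemma has_derivative_grad:
  assumes "f differentiable at z"
  shows "(f has_derivative (\<lambda>v. grad f z \<bullet> v)) (at z)"
proof -
  have f': "(f has_derivative frechet_derivative f (at z)) (at z)"
    using assms by (simp add: frechet_derivative_works)
  have "frechet_derivative f (at z) v = grad f z \<bullet> v" for v
  proof -
    have "frechet_derivative f (at z) v = frechet_derivative f (at z) (\<Sum>i\<in>UNIV. v $ i *\<^sub>R axis i 1)"
      using basis_expansion[of v] by (simp add: scalar_mult_eq_scaleR)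
    then show ?thesis
      using has_derivative_linear[OF f']
      by (simp add: linear_sum linear_scale grad_def inner_vec_def mult.commute)
  qed
  then have "frechet_derivative f (at z) = (\<lambda>v. grad f z \<bullet> v)"
    by (rule ext)
  with f' show ?thesis by simp
qed

lemma has_derivative_hess:
  assumes "grad f differentiable at z"
  shows "(grad f has_derivative (\<lambda>v. hess f z *v v)) (at z)"
proof -
  have "(grad f has_derivative frechet_derivative (grad f) (at z)) (at z)"
    using assms by (simp add: frechet_derivative_works)
  then show ?thesis
    unfolding hess_def by (metis matrix_vector_mul has_derivative_linear)
qed

lemma smooth_on_grad_family:
  fixes H :: "'t::real_normed_vector \<Rightarrow> real^'m::finite \<Rightarrow> real"
  assumes W: "open W" and H: "smooth_on W (\<lambda>(t, z). H t z)"
  shows "smooth_on W (\<lambda>(t, z). grad (H t) z)"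
proof -
  let ?H' = "\<lambda>p. frechet_derivative (\<lambda>(t, z). H t z) (at p)"
  have "grad (H t) z = (\<chi> i. ?H' (t, z) (0, axis i 1))" if "(t, z) \<in> W" for t z
    unfolding grad_def frechet_derivative_at[OF smooth_on_has_derivative_slice[OF W H that], symmetric] ..
  moreover have "smooth_on W (\<lambda>p. \<chi> i. ?H' p (0, axis i 1))"
    by (intro smooth_on_vec_lambda smooth_on_frechet_derivative[OF W H])
  ultimately show ?thesis
    unfolding smooth_on_def by (auto intro: Ck_on_cong[OF W])
qed

lemma smooth_on_has_derivative_grad_hess:
  fixes H :: "'t::real_normed_vector \<Rightarrow> real^'m::finite \<Rightarrow> real"
  assumes W: "open W" and H: "smooth_on W (\<lambda>(t, z). H t z)" and "(t, z) \<in> W"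
  shows "(H t has_derivative (\<lambda>v. grad (H t) z \<bullet> v)) (at z)"
    and "(grad (H t) has_derivative (\<lambda>v. hess (H t) z *v v)) (at z)"
  using smooth_on_has_derivative_slice[OF W H]
    smooth_on_has_derivative_slice[OF W smooth_on_grad_family[OF W H]] assms(3)
  by (blast intro: has_derivative_grad has_derivative_hess differentiableI)+

lemma continuous_on_hess_family:
  fixes H :: "'t::real_normed_vector \<Rightarrow> real^'m::finite \<Rightarrow> real"
  assumes W: "open W" and H: "smooth_on W (\<lambda>(t, z). H t z)"
  shows "continuous_on W (\<lambda>(t, z). hess (H t) z)"
proof -
  let ?G' = "\<lambda>p. frechet_derivative (\<lambda>(t, z). grad (H t) z) (at p)"
  note grad_smooth = smooth_on_grad_family[OF W H]
  have "hess (H t) z = (\<chi> i j. ?G' (t, z) (0, axis j 1) $ i)" if "(t, z) \<in> W" for t z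
    unfolding hess_def matrix_def
      frechet_derivative_at[OF smooth_on_has_derivative_slice[OF W grad_smooth that], symmetric] ..
  moreover have "continuous_on W (\<lambda>p. \<chi> i j. ?G' p (0, axis j 1) $ i)"
    by (intro continuous_on_vec_lambda continuous_on_component smooth_on_imp_continuous_on
        smooth_on_frechet_derivative[OF W grad_smooth])
  ultimately show ?thesis
    by (subst continuous_on_cong[OF refl, where g="\<lambda>p. \<chi> i j. ?G' p (0, axis j 1) $ i"]) auto
qed

lemma smooth_on_grad_snd:
  fixes f :: "real^'m::finite \<Rightarrow> real"
  assumes "open U" "smooth_on U f"
  shows "smooth_on (UNIV \<times> U) (\<lambda>(t::'t::real_normed_vector, x). grad f x)"
  using assms by (intro smooth_on_grad_family smooth_on_snd open_Times open_UNIV)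

lemma smooth_on_has_derivative_grad:
  fixes f :: "real^'m::finite \<Rightarrow> real"
  assumes "open U" "smooth_on U f" "x \<in> U"
  shows "(f has_derivative (\<lambda>v. grad f x \<bullet> v)) (at x)"
  using smooth_on_frechet_derivative(1)[OF assms] by (blast intro: has_derivative_grad differentiableI)

lemma smooth_on_imp_continuous_on_grad:
  fixes f :: "real^'m::finite \<Rightarrow> real"
  assumes "open U" "smooth_on U f"
  shows "continuous_on U (grad f)"
proof -
  have "continuous_on (UNIV \<times> U) (\<lambda>(t::real, x). grad f x)"
    by (rule smooth_on_imp_continuous_on[OF smooth_on_grad_snd[OF assms]])
  then have "continuous_on U (\<lambda>x. (\<lambda>(t::real, x). grad f x) (0, x))"
    by (rule continuous_on_compose2) (auto intro!: continuous_intros)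
  then show ?thesis by simp
qed

lemma Ck_on_1_bilinear:
  assumes "bounded_bilinear bprod" and f: "Ck_on 1 U f" and g: "Ck_on 1 U g"
  shows "Ck_on 1 U (\<lambda>x. bprod (f x) (g x))"
proof -
  interpret bounded_bilinear bprod by fact
  obtain f' g' where f': "\<And>x. x \<in> U \<Longrightarrow> (f has_derivative f' x) (at x)" "\<And>v. continuous_on U (\<lambda>x. f' x v)"
    and g': "\<And>x. x \<in> U \<Longrightarrow> (g has_derivative g' x) (at x)" "\<And>v. continuous_on U (\<lambda>x. g' x v)"
    using f g unfolding One_nat_def Ck_on.simps by metis
  have "continuous_on U f" "continuous_on U g"
    using has_derivative_continuous_on[OF has_derivative_at_withinI[OF f'(1)]]
      has_derivative_continuous_on[OF has_derivative_at_withinI[OF g'(1)]] by blast+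
  then have "continuous_on U (\<lambda>x. bprod (f x) (g' x v) + bprod (f' x v) (g x))" for v
    by (intro continuous_on_add continuous_on f'(2) g'(2))
  moreover have "((\<lambda>x. bprod (f x) (g x)) has_derivative
      (\<lambda>v. bprod (f x) (g' x v) + bprod (f' x v) (g x))) (at x)"
    if "x \<in> U" for x
    by (rule FDERIV[OF f'(1)[OF that] g'(1)[OF that]])
  ultimately show ?thesis
    unfolding One_nat_def Ck_on.simps
    by (intro exI[of _ "\<lambda>x v. bprod (f x) (g' x v) + bprod (f' x v) (g x)"]) blast
qed

lemma C1_uniformly_lipschitz_on:
  fixes f :: "'t::real_normed_vector \<Rightarrow> 'a::euclidean_space \<Rightarrow> 'b::real_normed_vector"
  assumes f: "Ck_on 1 W (\<lambda>(t, x). f t x)"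
    and K: "compact T" "compact K" "convex K" "T \<times> K \<subseteq> W"
  obtains L where "L \<ge> 0" "\<And>t. t \<in> T \<Longrightarrow> L-lipschitz_on K (f t)"
proof -
  obtain f' where f': "\<And>p. p \<in> W \<Longrightarrow> ((\<lambda>(t, x). f t x) has_derivative f' p) (at p)"
    and cont: "\<And>v. continuous_on W (\<lambda>p. f' p v)"
    using f by auto
  have "continuous_on (T \<times> K) (\<lambda>p. \<Sum>b\<in>Basis. norm (f' p (0, b)))"
    using continuous_on_subset[OF cont K(4)] by (intro continuous_intros)
  then have "bounded ((\<lambda>p. \<Sum>b\<in>Basis. norm (f' p (0, b))) ` (T \<times> K))"
    using K by (intro compact_imp_bounded compact_continuous_image compact_Times)
  then obtain L where "L > 0" and L: "\<And>p. p \<in> T \<times> K \<Longrightarrow> (\<Sum>b\<in>Basis. norm (f' p (0, b))) \<le> L"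
    unfolding bounded_pos by force
  have "L-lipschitz_on K (f t)" if t: "t \<in> T" for t
  proof (rule bounded_derivative_imp_lipschitz)
    fix x assume x: "x \<in> K"
    have slice: "(f t has_derivative (\<lambda>v. f' (t, x) (0, v))) (at x)"
      using t x K(4) by (intro has_derivative_slice f') auto
    then show "(f t has_derivative (\<lambda>v. f' (t, x) (0, v))) (at x within K)"
      by (rule has_derivative_at_withinI)
    show "onorm (\<lambda>v. f' (t, x) (0, v)) \<le> L"
      using L[of "(t, x)"] t x
      by (intro onorm_componentwise_le has_derivative_bounded_linear[OF slice]) auto
  qed (use K \<open>L > 0\<close> in auto)
  with \<open>L > 0\<close> show thesis
    by (intro that[of L]) auto
qed

section \<open>Gronwall's inequality and local solutions of Lipschitz equations\<close>

lemma norm_le_of_inner_derivative_nonpos: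
  fixes u :: "real \<Rightarrow> 'a::real_inner"
  assumes "a \<le> b"
    and der: "\<And>t. t \<in> {a..b} \<Longrightarrow> (u has_vector_derivative u' t) (at t within {a..b})"
    and nonpos: "\<And>t. t \<in> {a..b} \<Longrightarrow> u t \<bullet> u' t \<le> 0"
  shows "norm (u b) \<le> norm (u a)"
proof -
  have der_sq: "((\<lambda>t. u t \<bullet> u t) has_field_derivative 2 * (u t \<bullet> u' t)) (at t within {a..b})"
    if "t \<in> {a..b}" for t
    using der[OF that] unfolding has_vector_derivative_def has_field_derivative_def
    by (auto intro!: derivative_eq_intros simp: algebra_simps inner_commute)
  have "u b \<bullet> u b \<le> u a \<bullet> u a"
  proof (rule DERIV_nonpos_imp_decreasing_open[OF \<open>a \<le> b\<close>])
    show "continuous_on {a..b} (\<lambda>t. u t \<bullet> u t)"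
      using der_sq by (rule DERIV_continuous_on)
    fix t assume t: "a < t" "t < b"
    then have "((\<lambda>t. u t \<bullet> u t) has_field_derivative 2 * (u t \<bullet> u' t)) (at t)"
      using der_sq[of t] by (simp add: at_within_Icc_at)
    then show "\<exists>y. ((\<lambda>t. u t \<bullet> u t) has_field_derivative y) (at t) \<and> y \<le> 0"
      using nonpos[of t] t by (intro exI[of _ "2 * (u t \<bullet> u' t)"]) auto
  qed
  then show ?thesis
    by (simp add: norm_le)
qed

lemma gronwall_norm_forward:
  fixes u :: "real \<Rightarrow> 'a::real_inner"
  assumes "a \<le> b"
    and der: "\<And>t. t \<in> {a..b} \<Longrightarrow> (u has_vector_derivative u' t) (at t within {a..b})"
    and bound: "\<And>t. t \<in> {a..b} \<Longrightarrow> norm (u' t) \<le> C * norm (u t)"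
  shows "norm (u b) \<le> exp (C * (b - a)) * norm (u a)"
proof -
  have inner_le: "u t \<bullet> u' t \<le> C * (u t \<bullet> u t)" if "t \<in> {a..b}" for t
  proof -
    have "u t \<bullet> u' t \<le> norm (u t) * (C * norm (u t))"
      using norm_cauchy_schwarz[of "u t" "u' t"] mult_left_mono[OF bound[OF that] norm_ge_zero[of "u t"]]
      by linarith
    then show ?thesis
      by (simp add: dot_square_norm power2_eq_square algebra_simps)
  qed
  have "norm (exp (- (C * b)) *\<^sub>R u b) \<le> norm (exp (- (C * a)) *\<^sub>R u a)"
  proof (rule norm_le_of_inner_derivative_nonpos[OF \<open>a \<le> b\<close>])
    fix t assume t: "t \<in> {a..b}"
    show "((\<lambda>t. exp (- (C * t)) *\<^sub>R u t) has_vector_derivative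
        exp (- (C * t)) *\<^sub>R (u' t - C *\<^sub>R u t)) (at t within {a..b})"
      using der[OF t] by (auto intro!: derivative_eq_intros simp: algebra_simps)
    show "(exp (- (C * t)) *\<^sub>R u t) \<bullet> (exp (- (C * t)) *\<^sub>R (u' t - C *\<^sub>R u t)) \<le> 0"
      using inner_le[OF t] by (simp add: inner_diff_right mult_nonneg_nonpos)
  qed
  then have "exp (C * b) * (exp (- (C * b)) * norm (u b)) \<le> exp (C * b) * (exp (- (C * a)) * norm (u a))"
    by simp
  moreover have "exp (C * b) * exp (- (C * b)) = 1" "exp (C * b) * exp (- (C * a)) = exp (C * (b - a))"
    by (simp_all add: right_diff_distrib flip: exp_add)
  ultimately show ?thesis
    by (simp only: mult.assoc[symmetric] mult_1)
qed

lemma gronwall_norm: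
  fixes u :: "real \<Rightarrow> 'a::real_inner"
  assumes der: "\<And>t. t \<in> {a..b} \<Longrightarrow> (u has_vector_derivative u' t) (at t within {a..b})"
    and bound: "\<And>t. t \<in> {a..b} \<Longrightarrow> norm (u' t) \<le> C * norm (u t)"
    and s: "s \<in> {a..b}" and t: "t \<in> {a..b}"
  shows "norm (u t) \<le> exp (C * \<bar>t - s\<bar>) * norm (u s)"
proof (cases "s \<le> t")
  case True
  have "norm (u t) \<le> exp (C * (t - s)) * norm (u s)"
  proof (rule gronwall_norm_forward[OF True])
    fix r assume "r \<in> {s..t}"
    with s t show "(u has_vector_derivative u' r) (at r within {s..t})" "norm (u' r) \<le> C * norm (u r)"
      by (auto intro: has_vector_derivative_within_subset[OF der] bound)
  qed
  with True show ?thesis by simp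
next
  case False
  have "norm (u (- (- t))) \<le> exp (C * (- t - - s)) * norm (u (- (- s)))"
  proof (rule gronwall_norm_forward[where u="\<lambda>r. u (- r)" and u'="\<lambda>r. - u' (- r)"])
    fix r assume r: "r \<in> {- s..- t}"
    have "(u has_vector_derivative u' (- r)) (at (- r) within uminus ` {- s..- t})"
      using r s t by (intro has_vector_derivative_within_subset[OF der]) auto
    moreover have "((\<lambda>r. - r) has_vector_derivative - 1) (at r within {- s..- t})"
      by (intro has_vector_derivative_minus has_vector_derivative_id)
    ultimately show "((\<lambda>r. u (- r)) has_vector_derivative - u' (- r)) (at r within {- s..- t})"
      using vector_diff_chain_within[of uminus "- 1" r "{- s..- t}" u] by (simp add: o_def)
    show "norm (- u' (- r)) \<le> C * norm (u (- r))"
      using r s t by (auto intro!: bound)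
  qed (use False in simp)
  with False show ?thesis by simp
qed

lemma vanishing_along_curve:
  fixes \<rho> :: "'a::real_inner \<Rightarrow> real"
  assumes \<gamma>: "\<And>\<tau>. \<tau> \<in> {a..b} \<Longrightarrow> (\<gamma> has_vector_derivative \<gamma>' \<tau>) (at \<tau> within {a..b})"
    and \<rho>: "\<And>\<tau>. \<tau> \<in> {a..b} \<Longrightarrow> (\<rho> has_derivative (\<lambda>v. G (\<gamma> \<tau>) \<bullet> v)) (at (\<gamma> \<tau>))"
    and bound: "\<And>\<tau>. \<tau> \<in> {a..b} \<Longrightarrow> \<bar>G (\<gamma> \<tau>) \<bullet> \<gamma>' \<tau>\<bar> \<le> C * \<bar>\<rho> (\<gamma> \<tau>)\<bar>"
    and zero: "s \<in> {a..b}" "\<rho> (\<gamma> s) = 0" and t: "t \<in> {a..b}"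
  shows "\<rho> (\<gamma> t) = 0"
proof -
  have "norm (\<rho> (\<gamma> t)) \<le> exp (C * \<bar>t - s\<bar>) * norm (\<rho> (\<gamma> s))"
  proof (rule gronwall_norm[OF _ _ zero(1) t])
    fix \<tau> assume \<tau>: "\<tau> \<in> {a..b}"
    show "((\<lambda>\<tau>. \<rho> (\<gamma> \<tau>)) has_vector_derivative G (\<gamma> \<tau>) \<bullet> \<gamma>' \<tau>) (at \<tau> within {a..b})"
      using has_derivative_compose[OF \<gamma>[OF \<tau>, unfolded has_vector_derivative_def] \<rho>[OF \<tau>]]
      by (simp add: has_vector_derivative_def)
    show "norm (G (\<gamma> \<tau>) \<bullet> \<gamma>' \<tau>) \<le> C * norm (\<rho> (\<gamma> \<tau>))"
      using bound[OF \<tau>] by simp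
  qed
  with zero(2) show ?thesis by simp
qed

lemma norm_integral_lipschitz_diff_le:
  fixes F :: "'a::banach \<Rightarrow> 'b::banach"
  assumes F: "K-lipschitz_on UNIV F" and cont: "continuous_on {a..s} f" "continuous_on {a..s} g"
    and dist: "\<And>\<tau>. \<tau> \<in> {a..s} \<Longrightarrow> dist (f \<tau>) (g \<tau>) \<le> B" and "a \<le> s"
  shows "norm (integral {a..s} (\<lambda>\<tau>. F (f \<tau>)) - integral {a..s} (\<lambda>\<tau>. F (g \<tau>))) \<le> K * B * (s - a)"
proof -
  have cont_F: "continuous_on {a..s} (\<lambda>\<tau>. F (f \<tau>))" "continuous_on {a..s} (\<lambda>\<tau>. F (g \<tau>))"
    using cont by (auto intro: continuous_on_compose2[OF lipschitz_on_continuous_on[OF F]])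
  have "norm (F (f \<tau>) - F (g \<tau>)) \<le> K * B" if "\<tau> \<in> {a..s}" for \<tau>
  proof -
    have "norm (F (f \<tau>) - F (g \<tau>)) \<le> K * dist (f \<tau>) (g \<tau>)"
      using lipschitz_on_normD[OF F] by (simp add: dist_norm)
    also have "\<dots> \<le> K * B"
      using dist[OF that] lipschitz_on_nonneg[OF F] by (rule mult_left_mono)
    finally show ?thesis .
  qed
  then have "norm (integral {a..s} (\<lambda>\<tau>. F (f \<tau>) - F (g \<tau>))) \<le> K * B * (s - a)"
    using \<open>a \<le> s\<close> cont_F by (intro integral_bound continuous_on_diff)
  then show ?thesis
    by (simp add: integral_diff integrable_continuous_interval cont_F)
qed

lemma picard_integral_equation:
  fixes F :: "'a::banach \<Rightarrow> 'a"
  assumes F: "K-lipschitz_on UNIV F" and h: "h > 0" "K * h \<le> 1 / 2"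
  obtains \<gamma> where "continuous_on {0..h} \<gamma>" "\<And>s. s \<in> {0..h} \<Longrightarrow> \<gamma> s = p + integral {0..s} (\<lambda>\<tau>. F (\<gamma> \<tau>))"
proof -
  define picard :: "(real \<Rightarrow>\<^sub>C 'a) \<Rightarrow> real \<Rightarrow> 'a"
    where "picard f s = p + integral {0..s} (\<lambda>\<tau>. F (apply_bcontfun f \<tau>))" for f s
  have "\<exists>g. (\<forall>s\<in>cbox 0 h. apply_bcontfun g s = picard f s) \<and>
      (\<forall>s. apply_bcontfun g s = picard f (clamp 0 h s))" for f
  proof -
    have "continuous_on {0..h} (\<lambda>\<tau>. F (apply_bcontfun f \<tau>))"
      by (rule continuous_on_compose2[OF lipschitz_on_continuous_on[OF F]]) auto
    then have "continuous_on (cbox 0 h) (picard f)"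
      unfolding picard_def
      by (auto intro!: continuous_intros indefinite_integral_continuous_1 integrable_continuous_interval)
    then show ?thesis
      by (rule continuous_on_cbox_bcontfunE) blast
  qed
  then obtain \<Phi> where picard_on: "\<And>f s. s \<in> {0..h} \<Longrightarrow> apply_bcontfun (\<Phi> f) s = picard f s"
    and picard_clamp: "\<And>f s. apply_bcontfun (\<Phi> f) s = picard f (clamp 0 h s)"
    by (metis box_real(2))
  have "dist (\<Phi> f) (\<Phi> g) \<le> 1 / 2 * dist f g" for f g
  proof (rule dist_bound)
    fix s
    have clamp: "clamp 0 h s \<in> {0..h}"
      using clamp_in_interval[of 0 h s] h by simp
    then have "dist (apply_bcontfun (\<Phi> f) s) (apply_bcontfun (\<Phi> g) s) \<le> K * dist f g * (clamp 0 h s - 0)"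
      unfolding picard_clamp picard_def dist_norm add_diff_cancel_left
      by (intro norm_integral_lipschitz_diff_le[OF F]) (simp_all add: dist_bounded flip: dist_norm)
    also have "\<dots> \<le> K * dist f g * h"
      using clamp lipschitz_on_nonneg[OF F] by (intro mult_left_mono) auto
    also have "\<dots> \<le> 1 / 2 * dist f g"
      using mult_right_mono[OF h(2) zero_le_dist[of f g]] by (simp add: algebra_simps)
    finally show "dist (apply_bcontfun (\<Phi> f) s) (apply_bcontfun (\<Phi> g) s) \<le> 1 / 2 * dist f g" .
  qed
  then obtain f where "\<Phi> f = f"
    using banach_fix_type[of "1 / 2" \<Phi>] by auto
  then show thesis
    using picard_on[of _ f] by (intro that[of "apply_bcontfun f"]) (auto simp: picard_def)
qed

lemma picard_lipschitz_on_UNIV: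
  fixes F :: "'a::banach \<Rightarrow> 'a"
  assumes F: "K-lipschitz_on UNIV F"
  obtains \<gamma> h where "h > 0" "\<gamma> 0 = p"
    "\<And>s. s \<in> {0..h} \<Longrightarrow> (\<gamma> has_vector_derivative F (\<gamma> s)) (at s within {0..h})"
proof -
  define h where "h = 1 / (2 * (K + 1))"
  have h: "h > 0" "K * h \<le> 1 / 2"
    using lipschitz_on_nonneg[OF F] by (simp_all add: h_def field_simps)
  obtain \<gamma> where cont: "continuous_on {0..h} \<gamma>"
    and integral_equation: "\<And>s. s \<in> {0..h} \<Longrightarrow> \<gamma> s = p + integral {0..s} (\<lambda>\<tau>. F (\<gamma> \<tau>))"
    using picard_integral_equation[OF F h] by blast
  have cont_F: "continuous_on {0..h} (\<lambda>\<tau>. F (\<gamma> \<tau>))"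
    by (rule continuous_on_compose2[OF lipschitz_on_continuous_on[OF F] cont]) simp
  show thesis
  proof (rule that[OF h(1)])
    show "\<gamma> 0 = p"
      using integral_equation[of 0] h by simp
    fix s assume s: "s \<in> {0..h}"
    have "((\<lambda>s. p + integral {0..s} (\<lambda>\<tau>. F (\<gamma> \<tau>))) has_vector_derivative 0 + F (\<gamma> s)) (at s within {0..h})"
      by (intro has_vector_derivative_add has_vector_derivative_const integral_has_vector_derivative cont_F s)
    then show "(\<gamma> has_vector_derivative F (\<gamma> s)) (at s within {0..h})"
      using has_vector_derivative_transform[OF s integral_equation] by simp
  qed
qed

text \<open>Extending \<open>F\<close> to the whole space through the nearest-point projection onto the ball
  reduces the local statement to the global one.\<close>

corollary picard_lipschitz_on_cball:
  fixes F :: "'a::euclidean_space \<Rightarrow> 'a"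
  assumes r: "r > 0" and F: "K-lipschitz_on (cball p r) F"
  obtains \<gamma> h where "h > 0" "\<gamma> 0 = p" "\<And>s. s \<in> {0..h} \<Longrightarrow> \<gamma> s \<in> cball p r"
    "\<And>s. s \<in> {0..h} \<Longrightarrow> (\<gamma> has_vector_derivative F (\<gamma> s)) (at s within {0..h})"
proof -
  let ?proj = "closest_point (cball p r)"
  have proj: "?proj x \<in> cball p r" for x
    using r by (intro closest_point_in_set) auto
  have "1-lipschitz_on UNIV ?proj"
    using r by (intro lipschitz_onI) (auto intro!: closest_point_lipschitz)
  moreover have "K-lipschitz_on (range ?proj) F"
    using proj by (intro lipschitz_on_subset[OF F]) auto
  ultimately have "(K * 1)-lipschitz_on UNIV (\<lambda>x. F (?proj x))"
    by (rule lipschitz_on_compose2)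
  from picard_lipschitz_on_UNIV[OF this] obtain \<gamma> h where h: "h > 0" and init: "\<gamma> 0 = p"
    and der: "\<And>s. s \<in> {0..h} \<Longrightarrow> (\<gamma> has_vector_derivative F (?proj (\<gamma> s))) (at s within {0..h})"
    by blast
  have "continuous_on {0..h} \<gamma>"
    using der by (rule continuous_on_vector_derivative)
  then obtain d where d: "d > 0" "\<And>s. s \<in> {0..h} \<Longrightarrow> dist s 0 < d \<Longrightarrow> dist (\<gamma> s) (\<gamma> 0) < r"
    using r h unfolding continuous_on_iff by (metis atLeastAtMost_iff less_imp_le order_refl)
  define h' where "h' = min h (d / 2)"
  have in_ball: "\<gamma> s \<in> cball p r" if "s \<in> {0..h'}" for s
    using d(2)[of s] that d(1) by (auto simp: h'_def init dist_commute)
  show thesis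
  proof (rule that[of h' \<gamma>, OF _ init in_ball])
    show "h' > 0" using h d by (simp add: h'_def)
    fix s assume s: "s \<in> {0..h'}"
    then have "(\<gamma> has_vector_derivative F (?proj (\<gamma> s))) (at s within {0..h'})"
      by (intro has_vector_derivative_within_subset[OF der]) (auto simp: h'_def)
    then show "(\<gamma> has_vector_derivative F (\<gamma> s)) (at s within {0..h'})"
      using in_ball[OF s] by (simp add: closest_point_self)
  qed
qed

section \<open>Zeros near points of small value\<close>

lemma zero_near_of_derivative_ge:
  fixes k :: "real \<Rightarrow> real"
  assumes der: "\<And>s. \<bar>s\<bar> \<le> \<tau> \<Longrightarrow> (k has_field_derivative k' s) (at s)"
    and slope: "m > 0" "\<And>s. \<bar>s\<bar> \<le> \<tau> \<Longrightarrow> m \<le> k' s"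
    and small: "\<bar>k 0\<bar> \<le> m * \<tau>"
  obtains s where "\<bar>s\<bar> \<le> \<bar>k 0\<bar> / m" "k s = 0"
proof -
  define \<sigma> where "\<sigma> = \<bar>k 0\<bar> / m"
  have \<sigma>: "0 \<le> \<sigma>" "\<sigma> \<le> \<tau>" "m * \<sigma> = \<bar>k 0\<bar>"
    using slope small by (simp_all add: \<sigma>_def field_simps)
  have growth: "k y - k x \<ge> m * (y - x)" if "- \<sigma> \<le> x" "x \<le> y" "y \<le> \<sigma>" for x y
  proof -
    have "k x - m * x \<le> k y - m * y"
    proof (rule DERIV_nonneg_imp_nondecreasing[OF \<open>x \<le> y\<close>])
      fix s assume "x \<le> s" "s \<le> y"
      then have s: "\<bar>s\<bar> \<le> \<tau>"
        using that \<sigma> by linarith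
      have "((\<lambda>s. k s - m * s) has_field_derivative k' s - m) (at s)"
        by (auto intro!: derivative_eq_intros der[OF s])
      then show "\<exists>y. ((\<lambda>s. k s - m * s) has_field_derivative y) (at s) \<and> 0 \<le> y"
        using slope(2)[OF s] by (intro exI[of _ "k' s - m"]) simp
    qed
    then show ?thesis by (simp add: algebra_simps)
  qed
  have "k 0 - k (- \<sigma>) \<ge> \<bar>k 0\<bar>" "k \<sigma> - k 0 \<ge> \<bar>k 0\<bar>"
    using growth[of "- \<sigma>" 0] growth[of 0 \<sigma>] \<sigma> by auto
  then have "k (- \<sigma>) \<le> 0" "k \<sigma> \<ge> 0"
    by linarith+
  moreover have "continuous_on {- \<sigma>..\<sigma>} k"
    using \<sigma> by (intro DERIV_continuous_on[where D=k'] DERIV_subset[OF der]) auto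
  ultimately obtain s where "- \<sigma> \<le> s" "s \<le> \<sigma>" "k s = 0"
    using IVT'[of k "- \<sigma>" 0 \<sigma>] \<sigma> by auto
  then show thesis
    using that[of s] by (simp add: \<sigma>_def abs_le_iff)
qed

lemma zero_near_in_ball_of_slope:
  fixes \<rho> :: "'a::real_inner \<Rightarrow> real"
  assumes der: "\<And>x. x \<in> ball p R \<Longrightarrow> (\<rho> has_derivative (\<lambda>v. G x \<bullet> v)) (at x)"
    and slope: "m > 0" "\<And>x. x \<in> ball p R \<Longrightarrow> m \<le> G x \<bullet> \<nu>"
    and \<tau>: "\<tau> * norm \<nu> \<le> R / 2" and x: "x \<in> ball p (R / 2)" and small: "\<bar>\<rho> x\<bar> \<le> m * \<tau>"
  obtains y where "y \<in> ball p R" "\<rho> y = 0" "dist x y \<le> norm \<nu> / m * \<bar>\<rho> x\<bar>"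
proof -
  have segment: "x + s *\<^sub>R \<nu> \<in> ball p R" if "\<bar>s\<bar> \<le> \<tau>" for s
  proof -
    have "\<bar>s\<bar> * norm \<nu> \<le> R / 2"
      using mult_right_mono[OF that, of "norm \<nu>"] \<tau> by simp
    moreover have "dist p (x + s *\<^sub>R \<nu>) \<le> dist p x + \<bar>s\<bar> * norm \<nu>"
      using dist_triangle[of p "x + s *\<^sub>R \<nu>" x] by (simp add: dist_norm)
    ultimately show ?thesis
      using x by simp
  qed
  have "((\<lambda>s. \<rho> (x + s *\<^sub>R \<nu>)) has_field_derivative G (x + s *\<^sub>R \<nu>) \<bullet> \<nu>) (at s)"
    if "\<bar>s\<bar> \<le> \<tau>" for s
  proof -
    have "((\<lambda>s. x + s *\<^sub>R \<nu>) has_derivative (\<lambda>v. v *\<^sub>R \<nu>)) (at s)"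
      by (auto intro!: derivative_eq_intros)
    from has_derivative_compose[OF this der[OF segment[OF that]]] show ?thesis
      by (simp add: has_field_derivative_def mult_commute_abs)
  qed
  from zero_near_of_derivative_ge[OF this slope(1) slope(2)[OF segment]] small
  obtain s where s: "\<bar>s\<bar> \<le> \<bar>\<rho> x\<bar> / m" "\<rho> (x + s *\<^sub>R \<nu>) = 0"
    by auto
  show thesis
  proof (rule that[OF _ s(2)])
    have "\<bar>\<rho> x\<bar> / m \<le> \<tau>"
      using small slope(1) by (simp add: pos_divide_le_eq mult.commute)
    with s(1) show "x + s *\<^sub>R \<nu> \<in> ball p R"
      by (intro segment) simp
    show "dist x (x + s *\<^sub>R \<nu>) \<le> norm \<nu> / m * \<bar>\<rho> x\<bar>"
      using mult_right_mono[OF s(1), of "norm \<nu>"] by (simp add: dist_norm mult.commute)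
  qed
qed

lemma zero_near_of_gradient_nonzero:
  fixes \<rho> :: "'a::real_inner \<Rightarrow> real"
  assumes U: "open U" "p \<in> U" and der: "\<And>x. x \<in> U \<Longrightarrow> (\<rho> has_derivative (\<lambda>v. G x \<bullet> v)) (at x)"
    and G: "continuous_on U G" and p: "\<rho> p = 0" "G p \<noteq> 0"
  obtains r C where "r > 0" "ball p r \<subseteq> U"
    "\<And>x. x \<in> ball p r \<Longrightarrow> \<exists>y\<in>U. \<rho> y = 0 \<and> dist x y \<le> C * \<bar>\<rho> x\<bar>"
proof -
  define \<nu> m where "\<nu> = G p" and "m = \<nu> \<bullet> \<nu> / 2"
  have \<nu>: "norm \<nu> > 0" and m: "m > 0"
    using p by (auto simp: \<nu>_def m_def)
  have "open (U \<inter> (\<lambda>x. G x \<bullet> \<nu>) -` {m<..})"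
    using U(1) G by (intro continuous_open_preimage continuous_intros) auto
  moreover have "p \<in> U \<inter> (\<lambda>x. G x \<bullet> \<nu>) -` {m<..}"
    using U(2) m by (simp add: m_def flip: \<nu>_def)
  ultimately obtain R where R: "R > 0" "ball p R \<subseteq> U \<inter> (\<lambda>x. G x \<bullet> \<nu>) -` {m<..}"
    using open_contains_ball by blast
  define \<tau> where "\<tau> = R / (2 * norm \<nu>)"
  have \<tau>: "\<tau> * norm \<nu> \<le> R / 2" "m * \<tau> > 0"
    using R(1) \<nu> m by (simp_all add: \<tau>_def)
  have "isCont \<rho> p"
    using der[OF U(2)] by (rule has_derivative_continuous)
  with \<tau>(2) obtain d where d: "d > 0" "\<And>x. dist x p < d \<Longrightarrow> dist (\<rho> x) (\<rho> p) < m * \<tau>"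
    unfolding continuous_at_eps_delta by blast
  show thesis
  proof (rule that)
    show "min (R / 2) d > 0" "ball p (min (R / 2) d) \<subseteq> U"
      using R d m by auto
    fix x assume x: "x \<in> ball p (min (R / 2) d)"
    have der_ball: "(\<rho> has_derivative (\<lambda>v. G y \<bullet> v)) (at y)"
      and slope_ball: "m \<le> G y \<bullet> \<nu>" if "y \<in> ball p R" for y
      using der R(2) that by (blast, fastforce)
    have "x \<in> ball p (R / 2)" "\<bar>\<rho> x\<bar> \<le> m * \<tau>"
      using d(2)[of x] x p(1) by (auto simp: dist_commute)
    from zero_near_in_ball_of_slope[OF der_ball m slope_ball \<tau>(1) this]
    show "\<exists>y\<in>U. \<rho> y = 0 \<and> dist x y \<le> norm \<nu> / m * \<bar>\<rho> x\<bar>"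
      using R(2) by blast
  qed
qed

section \<open>The standard symplectic structure\<close>

lemma J0_nth [simp]: "J0 u $ Inl j = - u $ Inr j" "J0 u $ Inr j = u $ Inl j"
  by (simp_all add: J0_def)

lemma inner_vec_sum_type:
  fixes u v :: "real^('n::finite + 'm::finite)"
  shows "u \<bullet> v = (\<Sum>j\<in>UNIV. u $ Inl j * v $ Inl j) + (\<Sum>j\<in>UNIV. u $ Inr j * v $ Inr j)"
  by (simp add: inner_vec_def UNIV_Plus_UNIV[symmetric] sum.Plus del: UNIV_Plus_UNIV)

lemma J0_inner: "J0 u \<bullet> v = - (u \<bullet> J0 v)"
  by (simp add: inner_vec_sum_type sum_negf)

lemma inner_J0_self: "u \<bullet> J0 u = 0"
  using J0_inner[of u u] by (simp add: inner_commute)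

lemma omega0_J0: "omega0 (J0 u) v = - (u \<bullet> v)"
  by (simp add: omega0_def inner_vec_sum_type sum_subtractf sum_negf)

lemma J0_J0: "J0 (J0 u) = - u"
  unfolding vec_eq_iff by (auto simp: J0_def split: sum.split)

lemma norm_J0 [simp]: "norm (J0 u) = norm u"
  by (simp add: norm_eq_sqrt_inner J0_inner J0_J0)

lemma inj_J0: "inj J0"
  by (metis J0_J0 injI neg_equal_iff_equal)

lemma linear_J0: "linear (J0 :: real^('n::finite + 'n) \<Rightarrow> _)"
  by (rule linearI; unfold vec_eq_iff) (auto simp: J0_def split: sum.split)

lemma bounded_bilinear_inner_J0: "bounded_bilinear (\<lambda>u v :: real^('n::finite + 'n). u \<bullet> J0 v)"
  using bounded_bilinear.comp[OF bounded_bilinear_inner bounded_linear_ident]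
    linear_J0[unfolded linear_conv_bounded_linear] by blast

lemma lipschitz_on_J0_iff: "K-lipschitz_on S (\<lambda>x. J0 (f x)) \<longleftrightarrow> K-lipschitz_on S f"
  by (simp add: lipschitz_on_def dist_norm linear_diff[OF linear_J0, symmetric])

section \<open>Local defining functions and the characteristic foliation\<close>

locale local_defining =
  fixes \<Omega> U :: "(real^'m::finite) set" and \<rho> :: "real^'m \<Rightarrow> real"
  assumes open_domain: "open \<Omega>" and open_nbhd: "open U" and smooth: "smooth_on U \<rho>"
    and mem_iff: "x \<in> U \<Longrightarrow> x \<in> \<Omega> \<longleftrightarrow> \<rho> x < 0"
    and grad_nonzero: "x \<in> U \<Longrightarrow> grad \<rho> x \<noteq> 0"
begin

lemmas C1_grad = smooth_on_grad_snd[OF open_nbhd smooth, unfolded smooth_on_def, rule_format, of 1]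
  and has_derivative = smooth_on_has_derivative_grad[OF open_nbhd smooth]
  and continuous_on_grad = smooth_on_imp_continuous_on_grad[OF open_nbhd smooth]

lemma frontier_iff:
  assumes x: "x \<in> U"
  shows "x \<in> frontier \<Omega> \<longleftrightarrow> \<rho> x = 0"
proof
  show "\<rho> x = 0" if frontier: "x \<in> frontier \<Omega>"
  proof (rule ccontr)
    assume "\<rho> x \<noteq> 0"
    with frontier have "\<rho> x > 0"
      using open_domain mem_iff[OF x] by (auto simp: frontier_def interior_open)
    moreover have "open (U \<inter> \<rho> -` {0<..})"
      using open_nbhd smooth by (intro continuous_open_preimage smooth_on_imp_continuous_on) auto
    moreover have "\<Omega> \<inter> (U \<inter> \<rho> -` {0<..}) = {}"
      using mem_iff by fastforce
    ultimately show False
      using frontier x open_Int_closure_eq_empty[of "U \<inter> \<rho> -` {0<..}" \<Omega>]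
      by (auto simp: frontier_def Int_commute)
  qed
  assume zero: "\<rho> x = 0"
  then have "x \<notin> \<Omega>"
    using mem_iff[OF x] by simp
  moreover have "x \<in> closure \<Omega>"
  proof (rule ccontr)
    assume "x \<notin> closure \<Omega>"
    moreover have "\<rho> x \<le> \<rho> y" if "y \<in> U - closure \<Omega>" for y
      using that mem_iff[of y] zero closure_subset[of \<Omega>] by force
    ultimately have "(\<lambda>v. grad \<rho> x \<bullet> v) = (\<lambda>v. 0)"
      using open_nbhd x
      by (intro differential_zero_maxmin[OF _ _ has_derivative[OF x], of "U - closure \<Omega>"]) auto
    from fun_cong[OF this, of "grad \<rho> x"] show False
      using grad_nonzero[OF x] by simp
  qed
  ultimately show "x \<in> frontier \<Omega>"
    using open_domain by (simp add: frontier_def interior_open)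
qed

lemma tangent_space_grad_orthogonal:
  assumes q: "q \<in> U" and w: "w \<in> tangent_space (frontier \<Omega>) q"
  shows "grad \<rho> q \<bullet> w = 0"
proof -
  obtain \<gamma> e where e: "e > 0" "\<And>s. s \<in> {-e<..<e} \<Longrightarrow> \<gamma> s \<in> frontier \<Omega>" and init: "\<gamma> 0 = q"
      and der: "(\<gamma> has_vector_derivative w) (at 0)"
    using w unfolding tangent_space_def by blast
  have zero: "\<rho> (\<gamma> s) = 0" if "\<gamma> s \<in> U" "s \<in> {-e<..<e}" for s
    using that e(2) frontier_iff by blast
  have "\<forall>\<^sub>F s in at 0. \<gamma> s \<in> U"
    using has_vector_derivative_continuous[OF der] open_nbhd q init
    by (auto simp: isCont_def intro: topological_tendstoD)
  moreover have "\<forall>\<^sub>F s in at 0. s \<in> {-e<..<e}"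
    using e by (intro eventually_at_in_open') auto
  ultimately have "\<forall>\<^sub>F s in at 0. \<rho> (\<gamma> s) \<le> \<rho> (\<gamma> 0)"
    by eventually_elim (use zero zero[of 0] e(1) q init in simp)
  moreover have "((\<lambda>s. \<rho> (\<gamma> s)) has_derivative (\<lambda>v. grad \<rho> q \<bullet> (v *\<^sub>R w))) (at 0)"
    using has_derivative_compose[OF der[unfolded has_vector_derivative_def], of \<rho>] has_derivative[OF q] init
    by blast
  ultimately have "(\<lambda>v. grad \<rho> q \<bullet> (v *\<^sub>R w)) = (\<lambda>v. 0)"
    by (intro has_derivative_local_max)
  from fun_cong[OF this, of 1] show ?thesis by simp
qed

end

lemma unif_convex_domain_local_defining:
  assumes "unif_convex_domain \<Omega>" "p \<in> frontier \<Omega>"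
  obtains U \<rho> where "local_defining \<Omega> U \<rho>" "p \<in> U"
  using assms unfolding unif_convex_domain_def local_defining_def by metis

lemma velocity_in_tangent_space:
  assumes s: "s \<in> {a<..<b}" and \<gamma>: "\<And>r. r \<in> {a..b} \<Longrightarrow> \<gamma> r \<in> S"
    and der: "(\<gamma> has_vector_derivative v) (at s within {a..b})"
  shows "v \<in> tangent_space S (\<gamma> s)"
  unfolding tangent_space_def
proof (intro CollectI exI conjI)
  have "((\<lambda>r. s + r) has_vector_derivative 1) (at 0)"
    by (auto intro!: derivative_eq_intros)
  then show "((\<lambda>r. \<gamma> (s + r)) has_vector_derivative v) (at 0)"
    using der s vector_diff_chain_at[of "\<lambda>r. s + r" 1 0 \<gamma> v] by (simp add: o_def at_within_Icc_at)
  show "min (s - a) (b - s) > 0"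
    using s by simp
  show "\<forall>r\<in>{- min (s - a) (b - s)<..<min (s - a) (b - s)}. \<gamma> (s + r) \<in> S"
    using s by (auto intro!: \<gamma>)
qed simp

lemma right_vector_derivative_of_constant:
  fixes k :: "real \<Rightarrow> 'a::real_normed_vector"
  assumes "a < b" and der: "(k has_vector_derivative D) (at a within {a..b})"
    and const: "\<And>s. s \<in> {a<..<b} \<Longrightarrow> k s = c"
  shows "D = 0"
proof -
  have nontrivial: "at a within {a..b} \<noteq> bot"
    using \<open>a < b\<close> by (simp add: at_within_Icc_at_right)
  have "\<forall>\<^sub>F s in at a within {a..b}. k s = c"
    unfolding eventually_at using \<open>a < b\<close> by (auto simp: dist_real_def intro!: exI[of _ "b - a"] const)
  then have "(k \<longlongrightarrow> c) (at a within {a..b})"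
    by (rule tendsto_eventually)
  moreover have "(k \<longlongrightarrow> k a) (at a within {a..b})"
    using has_vector_derivative_continuous[OF der] by (simp add: continuous_within)
  ultimately have "k a = c"
    using tendsto_unique[OF nontrivial] by blast
  then have "k s = c" if "s \<in> {a..<b}" for s
    using that const by (cases "s = a") auto
  then have "(k has_vector_derivative 0) (at a within {a..<b})"
    using \<open>a < b\<close> by (intro has_vector_derivative_transform[OF _ _ has_vector_derivative_const[of c]]) auto
  moreover have "at a within {a..<b} = at a within {a..b}"
    using \<open>a < b\<close> by (intro at_within_nhd[of a "{..<b}"]) auto
  ultimately show "D = 0"
    using vector_derivative_unique_within[OF nontrivial der] by simp
qed

lemma characteristic_curve_exists:
  fixes \<Omega> :: "(real^('n::finite + 'n)) set"
  assumes "local_defining \<Omega> U \<rho>" and p: "p \<in> U" "p \<in> frontier \<Omega>"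
  obtains \<gamma> h where "h > 0" "\<gamma> 0 = p" "\<And>s. s \<in> {0..h} \<Longrightarrow> \<gamma> s \<in> U" "\<And>s. s \<in> {0..h} \<Longrightarrow> \<gamma> s \<in> frontier \<Omega>"
    "\<And>s. s \<in> {0..h} \<Longrightarrow> (\<gamma> has_vector_derivative J0 (grad \<rho> (\<gamma> s))) (at s within {0..h})"
proof -
  interpret local_defining \<Omega> U \<rho> by fact
  obtain r where r: "r > 0" "cball p r \<subseteq> U"
    using open_nbhd p open_contains_cball by blast
  have "{0} \<times> cball p r \<subseteq> UNIV \<times> U"
    using r(2) by blast
  from C1_uniformly_lipschitz_on[OF C1_grad compact_sing compact_cball convex_cball this]
  obtain L where "L-lipschitz_on (cball p r) (grad \<rho>)"
    by blast
  then have "L-lipschitz_on (cball p r) (\<lambda>x. J0 (grad \<rho> x))"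
    by (simp add: lipschitz_on_J0_iff)
  from picard_lipschitz_on_cball[OF r(1) this]
  obtain \<gamma> h where h: "h > 0" "\<gamma> 0 = p" "\<And>s. s \<in> {0..h} \<Longrightarrow> \<gamma> s \<in> cball p r"
    and der: "\<And>s. s \<in> {0..h} \<Longrightarrow> (\<gamma> has_vector_derivative J0 (grad \<rho> (\<gamma> s))) (at s within {0..h})"
    by blast
  have in_U: "\<gamma> s \<in> U" if "s \<in> {0..h}" for s
    using h(3)[OF that] r by blast
  have "((\<lambda>s. \<rho> (\<gamma> s)) has_derivative (\<lambda>v. 0)) (at s within {0..h})" if "s \<in> {0..h}" for s
    using has_derivative_compose[OF der[OF that, unfolded has_vector_derivative_def]
        has_derivative[OF in_U[OF that]]]
    by (simp add: inner_J0_self)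
  then have "\<rho> (\<gamma> s) = \<rho> (\<gamma> 0)" if "s \<in> {0..h}" for s
    using has_derivative_zero_unique[of "{0..h}" "\<lambda>s. \<rho> (\<gamma> s)" s 0] that h by auto
  then have "\<gamma> s \<in> frontier \<Omega>" if "s \<in> {0..h}" for s
    using frontier_iff in_U that p h(2) by simp
  from that[OF h(1,2) in_U this der] show thesis .
qed

lemma J0_grad_in_char_kernel:
  assumes "local_defining \<Omega> U \<rho>" "q \<in> U" "J0 (grad \<rho> q) \<in> tangent_space (frontier \<Omega>) q"
  shows "J0 (grad \<rho> q) \<in> char_kernel (frontier \<Omega>) q"
  using assms local_defining.tangent_space_grad_orthogonal[OF assms(1,2)]
  by (simp add: char_kernel_def omega0_J0)

lemma const_on_char_leaves_gradient_tangent: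
  fixes \<Omega> :: "(real^('n::finite + 'n)) set"
  assumes loc: "local_defining \<Omega> U \<rho>" and p: "p \<in> U" "p \<in> frontier \<Omega>"
    and leaves: "const_on_char_leaves \<Omega> f" and f: "(f has_derivative (\<lambda>v. g \<bullet> v)) (at p)"
  shows "grad \<rho> p \<bullet> J0 g = 0"
proof -
  obtain \<gamma> h where h: "h > 0" "\<gamma> 0 = p" and in_U: "\<And>s. s \<in> {0..h} \<Longrightarrow> \<gamma> s \<in> U"
    and frontier: "\<And>s. s \<in> {0..h} \<Longrightarrow> \<gamma> s \<in> frontier \<Omega>"
    and der: "\<And>s. s \<in> {0..h} \<Longrightarrow> (\<gamma> has_vector_derivative J0 (grad \<rho> (\<gamma> s))) (at s within {0..h})"
    using characteristic_curve_exists[OF loc p] by blast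
  have kernel: "J0 (grad \<rho> (\<gamma> s)) \<in> char_kernel (frontier \<Omega>) (\<gamma> s)" if "s \<in> {0<..<h}" for s
    using that by (intro J0_grad_in_char_kernel[OF loc] velocity_in_tangent_space[where a=0 and b=h]
        in_U frontier der) auto
  have leaf: "f (\<gamma> a) = f (\<gamma> b)" if "0 < a" "a \<le> b" "b < h" for a b
  proof -
    have "\<gamma> s \<in> frontier \<Omega> \<and> (\<exists>v. (\<gamma> has_vector_derivative v) (at s within {a..b}) \<and>
        v \<in> char_kernel (frontier \<Omega>) (\<gamma> s))" if "s \<in> {a..b}" for s
    proof (intro conjI exI)
      show "(\<gamma> has_vector_derivative J0 (grad \<rho> (\<gamma> s))) (at s within {a..b})"
        using that \<open>0 < a\<close> \<open>b < h\<close> by (intro has_vector_derivative_within_subset[OF der]) auto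
    qed (use that \<open>0 < a\<close> \<open>b < h\<close> in \<open>auto intro!: frontier kernel\<close>)
    with leaves \<open>a \<le> b\<close> show ?thesis
      unfolding const_on_char_leaves_def by blast
  qed
  have "f (\<gamma> s) = f (\<gamma> (h / 2))" if "s \<in> {0<..<h}" for s
    using leaf[of s "h / 2"] leaf[of "h / 2" s] that by (cases "s \<le> h / 2") auto
  moreover have "(\<gamma> has_derivative (\<lambda>v. v *\<^sub>R J0 (grad \<rho> p))) (at 0 within {0..h})"
    using der[of 0] h by (simp add: has_vector_derivative_def)
  from has_derivative_compose[OF this, of f "\<lambda>v. g \<bullet> v"] f h
  have "((\<lambda>s. f (\<gamma> s)) has_vector_derivative g \<bullet> J0 (grad \<rho> p)) (at 0 within {0..h})"
    by (simp add: has_vector_derivative_def)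
  ultimately have "g \<bullet> J0 (grad \<rho> p) = 0"
    using right_vector_derivative_of_constant[OF h(1)] by blast
  then show ?thesis
    using J0_inner[of "grad \<rho> p" g] by (simp add: inner_commute)
qed

section \<open>The flow of a positive path\<close>

lemma closure_open_eq_Un_frontier: "open S \<Longrightarrow> closure S = S \<union> frontier S"
  by (simp add: closure_Un_frontier[symmetric] Un_commute)

locale hamiltonian_path =
  fixes \<Omega> :: "(real^('n::finite + 'n)) set"
    and \<phi> :: "real \<Rightarrow> real^('n + 'n) \<Rightarrow> real^('n + 'n)"
    and H :: "real \<Rightarrow> real^('n + 'n) \<Rightarrow> real"
  assumes domain: "unif_convex_domain \<Omega>" and nonempty: "\<Omega> \<noteq> {}"
    and positive: "positive_path \<Omega> \<phi> H"
begin

lemma domain_open: "open \<Omega>" and domain_bounded: "bounded \<Omega>" and domain_convex: "convex \<Omega>"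
  using domain by (simp_all add: unif_convex_domain_def)

lemma closure_domain_compact: "compact (closure \<Omega>)" and closure_domain_convex: "convex (closure \<Omega>)"
  by (simp_all add: domain_bounded domain_convex compact_closure convex_closure)

lemma generator_smooth_nbhd:
  obtains W where "open W" "{0..1} \<times> closure \<Omega> \<subseteq> W" "smooth_on W (\<lambda>(t, z). H t z)"
  using positive unfolding positive_path_def by blast

lemma has_derivative_generator:
  assumes "t \<in> {0..1}" "z \<in> closure \<Omega>"
  shows "(H t has_derivative (\<lambda>v. grad (H t) z \<bullet> v)) (at z)"
    and "(grad (H t) has_derivative (\<lambda>v. hess (H t) z *v v)) (at z)"
proof -
  obtain W where W: "open W" "{0..1} \<times> closure \<Omega> \<subseteq> W" "smooth_on W (\<lambda>(t, z). H t z)"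
    by (rule generator_smooth_nbhd)
  with assms have "(t, z) \<in> W" by blast
  then show "(H t has_derivative (\<lambda>v. grad (H t) z \<bullet> v)) (at z)"
    "(grad (H t) has_derivative (\<lambda>v. hess (H t) z *v v)) (at z)"
    by (rule smooth_on_has_derivative_grad_hess[OF W(1,3)])+
qed

lemma continuous_on_hess: "continuous_on ({0..1} \<times> closure \<Omega>) (\<lambda>(t, z). hess (H t) z)"
  by (rule generator_smooth_nbhd) (blast intro: continuous_on_subset continuous_on_hess_family)

lemma pos_def_hess: "t \<in> {0..1} \<Longrightarrow> z \<in> closure \<Omega> \<Longrightarrow> pos_def (hess (H t) z)"
  using positive unfolding positive_path_def by blast

lemma flow_derivative:
  assumes "t \<in> {0..1}" "z \<in> closure \<Omega>"
  shows "((\<lambda>s. \<phi> s z) has_vector_derivative J0 (grad (H t) (\<phi> t z))) (at t within {0..1})"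
  using positive assms unfolding positive_path_def by blast

lemma flow_initial: "z \<in> closure \<Omega> \<Longrightarrow> \<phi> 0 z = z"
  using positive unfolding positive_path_def by blast

lemma continuous_on_flow_time: "z \<in> closure \<Omega> \<Longrightarrow> continuous_on {0..1} (\<lambda>t. \<phi> t z)"
  by (rule continuous_on_vector_derivative[OF flow_derivative])

lemma generator_gradient_tangent:
  assumes loc: "local_defining \<Omega> U \<rho>" and p: "p \<in> U" "\<rho> p = 0" and t: "t \<in> {0..1}"
  shows "grad \<rho> p \<bullet> J0 (grad (H t) p) = 0"
proof (rule const_on_char_leaves_gradient_tangent[OF loc p(1)])
  show "p \<in> frontier \<Omega>"
    using local_defining.frontier_iff[OF loc] p by blast
  then show "(H t has_derivative (\<lambda>v. grad (H t) p \<bullet> v)) (at p)"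
    using t by (intro has_derivative_generator) (auto simp: frontier_def)
  show "const_on_char_leaves \<Omega> (H t)"
    using positive t unfolding positive_path_def by blast
qed

lemma normal_velocity_lipschitz:
  assumes "local_defining \<Omega> U \<rho>" and p: "p \<in> U" "p \<in> closure \<Omega>"
  obtains R L where "R > 0" "cball p R \<subseteq> U"
    "\<And>t. t \<in> {0..1} \<Longrightarrow> L-lipschitz_on (cball p R) (\<lambda>x. grad \<rho> x \<bullet> J0 (grad (H t) x))"
proof -
  interpret local_defining \<Omega> U \<rho> by fact
  obtain W where W: "open W" "{0..1} \<times> closure \<Omega> \<subseteq> W" "smooth_on W (\<lambda>(t, z). H t z)"
    by (rule generator_smooth_nbhd)
  have "compact ({0..1::real} \<times> closure \<Omega>)"
    using closure_domain_compact by (intro compact_Times) auto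
  then obtain \<epsilon> where \<epsilon>: "\<epsilon> > 0" "(\<Union>q\<in>{0..1} \<times> closure \<Omega>. cball q \<epsilon>) \<subseteq> W"
    using compact_subset_open_imp_cball_epsilon_subset[OF _ W(1,2)] by blast
  obtain r where r: "r > 0" "cball p r \<subseteq> U"
    using open_nbhd p open_contains_cball by blast
  define R where "R = min r \<epsilon>"
  have R: "R > 0" "cball p R \<subseteq> U"
    using r \<epsilon> by (auto simp: R_def)
  define V where "V = W \<inter> UNIV \<times> U"
  have "(t, x) \<in> W" if "t \<in> {0..1}" "x \<in> cball p R" for t :: real and x
    using \<epsilon>(2) that p(2) by (force simp: R_def dist_Pair_Pair)
  then have subset_V: "{0..1} \<times> cball p R \<subseteq> V"
    using R(2) by (auto simp: V_def)
  have "Ck_on 1 V (\<lambda>(t, x). grad \<rho> x)" "Ck_on 1 V (\<lambda>(t, x). grad (H t) x)"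
    using C1_grad smooth_on_grad_family[OF W(1,3)]
    unfolding smooth_on_def V_def by (blast intro: Ck_on_subset)+
  from Ck_on_1_bilinear[OF bounded_bilinear_inner_J0 this]
  have "Ck_on 1 V (\<lambda>(t, x). grad \<rho> x \<bullet> J0 (grad (H t) x))"
    by (simp add: case_prod_beta')
  from C1_uniformly_lipschitz_on[OF this _ _ _ subset_V] obtain L
    where "\<And>t. t \<in> {0..1} \<Longrightarrow> L-lipschitz_on (cball p R) (\<lambda>x. grad \<rho> x \<bullet> J0 (grad (H t) x))"
    by auto
  with R show thesis
    by (rule that)
qed

lemma normal_velocity_bound:
  assumes loc: "local_defining \<Omega> U \<rho>" and p: "p \<in> U" "p \<in> frontier \<Omega>"
  obtains r C where "r > 0" "ball p r \<subseteq> U"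
    "\<And>t x. t \<in> {0..1} \<Longrightarrow> x \<in> ball p r \<Longrightarrow> \<bar>grad \<rho> x \<bullet> J0 (grad (H t) x)\<bar> \<le> C * \<bar>\<rho> x\<bar>"
proof -
  interpret local_defining \<Omega> U \<rho> by (rule loc)
  have "p \<in> closure \<Omega>"
    using p by (simp add: frontier_def)
  then obtain R L where R: "R > 0" "cball p R \<subseteq> U" and lipschitz:
    "\<And>t. t \<in> {0..1} \<Longrightarrow> L-lipschitz_on (cball p R) (\<lambda>x. grad \<rho> x \<bullet> J0 (grad (H t) x))"
    using normal_velocity_lipschitz[OF loc p(1)] by blast
  have der_ball: "(\<rho> has_derivative (\<lambda>v. grad \<rho> x \<bullet> v)) (at x)" if "x \<in> ball p R" for x
    using has_derivative[OF subsetD[OF R(2)]] that by simp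
  have cont_ball: "continuous_on (ball p R) (grad \<rho>)"
    using continuous_on_grad by (rule continuous_on_subset) (use R in auto)
  have "p \<in> ball p R" "\<rho> p = 0"
    using frontier_iff[OF p(1)] p R(1) by auto
  from zero_near_of_gradient_nonzero[OF open_ball this(1) der_ball cont_ball this(2) grad_nonzero[OF p(1)]]
  obtain r C where r: "r > 0" "ball p r \<subseteq> ball p R"
    and near_zero: "\<And>x. x \<in> ball p r \<Longrightarrow> \<exists>y\<in>ball p R. \<rho> y = 0 \<and> dist x y \<le> C * \<bar>\<rho> x\<bar>"
    by blast
  show thesis
  proof (rule that[OF r(1)])
    show "ball p r \<subseteq> U"
      using r(2) R(2) ball_subset_cball by blast
    fix t x assume t: "t \<in> {0..1::real}" and x: "x \<in> ball p r"
    obtain y where y: "y \<in> ball p R" "\<rho> y = 0" "dist x y \<le> C * \<bar>\<rho> x\<bar>"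
      using near_zero[OF x] by blast
    have "\<bar>grad \<rho> x \<bullet> J0 (grad (H t) x) - grad \<rho> y \<bullet> J0 (grad (H t) y)\<bar> \<le> L * dist x y"
      using lipschitz_onD[OF lipschitz[OF t], of x y] x y(1) r(2) by (auto simp: dist_real_def)
    also have "\<dots> \<le> L * (C * \<bar>\<rho> x\<bar>)"
      using y(3) lipschitz_on_nonneg[OF lipschitz[OF t]] by (rule mult_left_mono)
    finally show "\<bar>grad \<rho> x \<bullet> J0 (grad (H t) x)\<bar> \<le> L * C * \<bar>\<rho> x\<bar>"
      using generator_gradient_tangent[OF loc _ y(2) t] subsetD[OF R(2), of y] y(1) by (simp add: mult.assoc)
  qed
qed

lemma frontier_times_open:
  assumes z: "z \<in> closure \<Omega>" and s: "s \<in> {0..1}" and p: "\<phi> s z \<in> frontier \<Omega>"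
  shows "\<exists>d>0. \<forall>t\<in>{0..1}. dist t s < d \<longrightarrow> \<phi> t z \<in> frontier \<Omega>"
proof -
  obtain U \<rho> where loc: "local_defining \<Omega> U \<rho>" and in_U: "\<phi> s z \<in> U"
    using unif_convex_domain_local_defining[OF domain p] .
  interpret local_defining \<Omega> U \<rho> by (rule loc)
  obtain r C where r: "r > 0" "ball (\<phi> s z) r \<subseteq> U" and bound: "\<And>t x. t \<in> {0..1} \<Longrightarrow>
      x \<in> ball (\<phi> s z) r \<Longrightarrow> \<bar>grad \<rho> x \<bullet> J0 (grad (H t) x)\<bar> \<le> C * \<bar>\<rho> x\<bar>"
    using normal_velocity_bound[OF loc in_U p] by blast
  obtain d where d: "d > 0" "\<And>t. t \<in> {0..1} \<Longrightarrow> dist t s < d \<Longrightarrow> dist (\<phi> t z) (\<phi> s z) < r"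
    using continuous_on_flow_time[OF z] r(1) s unfolding continuous_on_iff by metis
  have "\<phi> t z \<in> frontier \<Omega>" if t: "t \<in> {0..1}" "dist t s < d" for t
  proof -
    define a b where "a = min s t" and "b = max s t"
    have times: "\<tau> \<in> {0..1}" "\<phi> \<tau> z \<in> ball (\<phi> s z) r" if "\<tau> \<in> {a..b}" for \<tau>
    proof -
      show "\<tau> \<in> {0..1}"
        using that s t by (auto simp: a_def b_def)
      moreover have "dist \<tau> s < d"
        using that t by (auto simp: a_def b_def dist_real_def)
      ultimately show "\<phi> \<tau> z \<in> ball (\<phi> s z) r"
        using d(2) by (simp add: dist_commute)
    qed
    have "\<rho> (\<phi> t z) = 0"
    proof (rule vanishing_along_curve[of a b "\<lambda>\<tau>. \<phi> \<tau> z" _ \<rho> "grad \<rho>"])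
      fix \<tau> assume \<tau>: "\<tau> \<in> {a..b}"
      show "((\<lambda>\<tau>. \<phi> \<tau> z) has_vector_derivative J0 (grad (H \<tau>) (\<phi> \<tau> z))) (at \<tau> within {a..b})"
        using has_vector_derivative_within_subset[OF flow_derivative[OF times(1)[OF \<tau>] z]] times(1) by blast
      show "(\<rho> has_derivative (\<lambda>v. grad \<rho> (\<phi> \<tau> z) \<bullet> v)) (at (\<phi> \<tau> z))"
        using has_derivative times(2)[OF \<tau>] r(2) by blast
      show "\<bar>grad \<rho> (\<phi> \<tau> z) \<bullet> J0 (grad (H \<tau>) (\<phi> \<tau> z))\<bar> \<le> C * \<bar>\<rho> (\<phi> \<tau> z)\<bar>"
        by (rule bound[OF times[OF \<tau>]])
    next
      show "\<rho> (\<phi> s z) = 0"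
        using frontier_iff[OF in_U] p by simp
    qed (auto simp: a_def b_def)
    then show ?thesis
      using frontier_iff times(2)[of t] r(2) by (auto simp: a_def b_def)
  qed
  with d(1) show ?thesis by blast
qed

lemma frontier_times_all_or_none:
  assumes z: "z \<in> closure \<Omega>" and t: "t \<in> {0..1}" "\<phi> t z \<in> frontier \<Omega>" and s: "s \<in> {0..1}"
  shows "\<phi> s z \<in> frontier \<Omega>"
proof -
  let ?S = "{t \<in> {0..1}. \<phi> t z \<in> frontier \<Omega>}"
  have "closedin (top_of_set {0..1}) ({0..1} \<inter> (\<lambda>t. \<phi> t z) -` frontier \<Omega>)"
    by (intro continuous_closedin_preimage continuous_on_flow_time z) auto
  then have "closedin (top_of_set {0..1}) ?S"
    by (simp add: vimage_def Int_def)
  moreover have "openin (top_of_set {0..1}) ?S"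
    unfolding openin_euclidean_subtopology_iff using frontier_times_open[OF z] by fastforce
  moreover have "connected {0..1::real}" by simp
  ultimately have "?S = {} \<or> ?S = {0..1}"
    unfolding connected_clopen by blast
  with t s show ?thesis by blast
qed

lemma flow_frontier: "z \<in> frontier \<Omega> \<Longrightarrow> t \<in> {0..1} \<Longrightarrow> \<phi> t z \<in> frontier \<Omega>"
  using frontier_times_all_or_none[of z 0 t] flow_initial[of z] by (auto simp: frontier_def)

lemma flow_interior:
  assumes z: "z \<in> \<Omega>" and t: "t \<in> {0..1}"
  shows "\<phi> t z \<in> \<Omega>"
proof (rule ccontr)
  assume "\<phi> t z \<notin> \<Omega>"
  have closure: "z \<in> closure \<Omega>"
    using z closure_subset by blast
  let ?orbit = "(\<lambda>t. \<phi> t z) ` {0..1}"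
  have "connected ?orbit"
    by (intro connected_continuous_image continuous_on_flow_time closure) auto
  moreover have "z \<in> ?orbit \<inter> \<Omega>"
    using z flow_initial[OF closure] by (auto intro!: image_eqI[of _ _ 0])
  moreover have "\<phi> t z \<in> ?orbit - \<Omega>"
    using t \<open>\<phi> t z \<notin> \<Omega>\<close> by blast
  ultimately have "?orbit \<inter> frontier \<Omega> \<noteq> {}"
    using connected_Int_frontier[of ?orbit \<Omega>] by blast
  then have "\<phi> 0 z \<in> frontier \<Omega>"
    using frontier_times_all_or_none[OF closure] by auto
  then show False
    using z flow_initial[OF closure] domain_open by (simp add: frontier_def interior_open)
qed

lemma flow_closure:
  assumes "z \<in> closure \<Omega>" "t \<in> {0..1}"
  shows "\<phi> t z \<in> closure \<Omega>"
  using assms flow_frontier flow_interior closure_open_eq_Un_frontier[OF domain_open]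
  by blast

lemma gradient_uniformly_lipschitz:
  obtains L where "L \<ge> 0" "\<And>t. t \<in> {0..1} \<Longrightarrow> L-lipschitz_on (closure \<Omega>) (grad (H t))"
proof -
  obtain W where W: "open W" "{0..1} \<times> closure \<Omega> \<subseteq> W" "smooth_on W (\<lambda>(t, z). H t z)"
    by (rule generator_smooth_nbhd)
  have "Ck_on 1 W (\<lambda>(t, z). grad (H t) z)"
    using smooth_on_grad_family[OF W(1,3)] unfolding smooth_on_def by blast
  from C1_uniformly_lipschitz_on[OF this _ closure_domain_compact closure_domain_convex W(2)] show thesis
    using that by blast
qed

lemma flow_uniformly_lipschitz:
  obtains K where "\<And>t. t \<in> {0..1} \<Longrightarrow> K-lipschitz_on (closure \<Omega>) (\<phi> t)"
proof -
  obtain L where L: "L \<ge> 0" "\<And>t. t \<in> {0..1} \<Longrightarrow> L-lipschitz_on (closure \<Omega>) (grad (H t))"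
    by (rule gradient_uniformly_lipschitz) blast
  have "(exp L)-lipschitz_on (closure \<Omega>) (\<phi> t)" if t: "t \<in> {0..1}" for t
  proof (rule lipschitz_onI)
    fix z w assume z: "z \<in> closure \<Omega>" and w: "w \<in> closure \<Omega>"
    have "norm (\<phi> t z - \<phi> t w) \<le> exp (L * \<bar>t - 0\<bar>) * norm (\<phi> 0 z - \<phi> 0 w)"
    proof (rule gronwall_norm[OF _ _ _ t])
      fix s :: real assume s: "s \<in> {0..1}"
      show "((\<lambda>s. \<phi> s z - \<phi> s w) has_vector_derivative
          J0 (grad (H s) (\<phi> s z)) - J0 (grad (H s) (\<phi> s w))) (at s within {0..1})"
        by (intro has_vector_derivative_diff flow_derivative s z w)
      show "norm (J0 (grad (H s) (\<phi> s z)) - J0 (grad (H s) (\<phi> s w))) \<le> L * norm (\<phi> s z - \<phi> s w)"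
        using lipschitz_on_normD[OF L(2)[OF s] flow_closure[OF z s] flow_closure[OF w s]]
        by (simp add: linear_diff[OF linear_J0, symmetric])
    qed simp
    also have "\<dots> \<le> exp L * norm (\<phi> 0 z - \<phi> 0 w)"
      using t L(1) by (intro mult_right_mono) (auto simp: mult_left_le)
    finally show "dist (\<phi> t z) (\<phi> t w) \<le> exp L * dist z w"
      using flow_initial z w by (simp add: dist_norm)
  qed simp
  then show thesis
    by (rule that)
qed

lemma continuous_on_flow: "continuous_on ({0..1} \<times> closure \<Omega>) (\<lambda>(t, z). \<phi> t z)"
proof -
  obtain K where "\<And>t. t \<in> {0..1} \<Longrightarrow> K-lipschitz_on (closure \<Omega>) (\<phi> t)"
    by (rule flow_uniformly_lipschitz) blast
  then have "K-lipschitz_on (cball z 1 \<inter> closure \<Omega>) (\<phi> t)" if "t \<in> {0..1}" for t z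
    using that by (meson inf_le2 lipschitz_on_subset)
  then have "local_lipschitz {0..1} (closure \<Omega>) \<phi>"
    unfolding local_lipschitz_def by (meson IntD2 zero_less_one)
  then show ?thesis
    by (rule continuous_on_TimesI) (rule continuous_on_flow_time)
qed

end

lemma continuous_on_slice:
  assumes "continuous_on (T \<times> K) (\<lambda>(t, z). h t z)" "t \<in> T"
  shows "continuous_on K (h t)"
proof -
  have "continuous_on K (\<lambda>z. (\<lambda>(t, z). h t z) (t, z))"
    by (rule continuous_on_compose2[OF assms(1)])
      (use assms(2) in \<open>auto intro!: continuous_on_Pair continuous_on_const continuous_on_id\<close>)
  then show ?thesis by simp
qed

lemma frontier_subset_retraction_up_to_homotopy:
  fixes S :: "'a::euclidean_space set"
  assumes "bounded S" "ANR (frontier S)"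
    and k: "continuous_on (closure S) k" "k \<in> closure S \<rightarrow> frontier S"
    and homotopic: "homotopic_with_canon (\<lambda>x. True) (frontier S) (frontier S) k (\<lambda>x. x)"
  shows "S \<subseteq> frontier S"
proof -
  have "closedin (top_of_set (closure S)) (frontier S)"
    by (intro closed_subset) (auto simp: frontier_def)
  then obtain g where "continuous_on (closure S) g" "g ` closure S \<subseteq> frontier S" "\<And>x. x \<in> frontier S \<Longrightarrow> g x = x"
    by (rule Borsuk_homotopy_extension_homotopic[OF _ _ k homotopic]) (use assms(2) in auto)
  then show ?thesis
    using frontier_subset_retraction[of S "frontier S" g] assms(1) closure_subset[of S]
    by (auto simp: image_subset_iff)
qed

text \<open>A missed point of \<open>S\<close> would let one compose with a retraction of the punctured space onto
  the frontier.\<close>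

lemma frontier_preserving_homotopy_surjective:
  fixes S :: "'a::euclidean_space set"
  assumes S: "open S" "bounded S" "convex S"
    and cont: "continuous_on ({0..1} \<times> closure S) (\<lambda>(t, z). h t z)"
    and front: "\<And>t z. t \<in> {0..1} \<Longrightarrow> z \<in> frontier S \<Longrightarrow> h t z \<in> frontier S"
    and init: "\<And>z. z \<in> closure S \<Longrightarrow> h 0 z = z" and t: "t \<in> {0..1::real}"
  shows "S \<subseteq> h t ` closure S"
proof (rule ccontr)
  assume "\<not> S \<subseteq> h t ` closure S"
  then obtain a where a: "a \<in> S" "a \<notin> h t ` closure S" by blast
  have frontier_closure: "frontier S \<subseteq> closure S"
    by (simp add: frontier_def)
  have retract: "frontier S retract_of (- {a})"
    using frontier_retract_of_punctured_universe[of S a] S a by (simp add: interior_open)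
  then obtain r where r: "continuous_on (- {a}) r" "r ` (- {a}) \<subseteq> frontier S" "\<And>x. x \<in> frontier S \<Longrightarrow> r x = x"
    unfolding retract_of_def retraction_def by blast
  have "continuous_on (closure S) (\<lambda>z. r (h t z))" "(\<lambda>z. r (h t z)) \<in> closure S \<rightarrow> frontier S"
    using a r(2) by (force intro!: continuous_on_compose2[OF r(1) continuous_on_slice[OF cont t]])+
  moreover have "homotopic_with_canon (\<lambda>x. True) (frontier S) (frontier S) (\<lambda>z. r (h t z)) (\<lambda>z. z)"
  proof (rule homotopic_with_symD, rule homotopic_with_eq)
    have "continuous_on ({0..1} \<times> frontier S) (\<lambda>p. (\<lambda>(t, z). h t z) (t * fst p, snd p))"
      by (rule continuous_on_compose2[OF cont])
        (use t frontier_closure in \<open>auto intro!: continuous_on_Pair continuous_intros mult_le_one\<close>)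
    then show "homotopic_with_canon (\<lambda>x. True) (frontier S) (frontier S) (h 0) (h t)"
      unfolding homotopic_with_def
      using t front by (intro exI[of _ "\<lambda>p. h (t * fst p) (snd p)"])
        (auto simp: case_prod_beta' mult_le_one continuous_map_in_subtopology)
  qed (use t front r init frontier_closure in auto)
  moreover have "ANR (frontier S)"
    using retract by (metis ANR_retract_of_ANR ENR_imp_ANR open_imp_ENR open_Compl closed_singleton)
  ultimately have "S \<subseteq> frontier S"
    using S(2) by (intro frontier_subset_retraction_up_to_homotopy)
  then show False
    using a S(1) by (auto simp: frontier_def interior_open)
qed

context hamiltonian_path
begin

lemma flow_closure_image:
  assumes t: "t \<in> {0..1}"
  shows "\<phi> t ` closure \<Omega> = closure \<Omega>"
proof
  show "\<phi> t ` closure \<Omega> \<subseteq> closure \<Omega>"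
    using flow_closure t by blast
  have "closed (\<phi> t ` closure \<Omega>)"
    using closure_domain_compact continuous_on_slice[OF continuous_on_flow t]
    by (intro compact_imp_closed compact_continuous_image)
  moreover have "\<Omega> \<subseteq> \<phi> t ` closure \<Omega>"
    by (rule frontier_preserving_homotopy_surjective[OF domain_open domain_bounded domain_convex
          continuous_on_flow flow_frontier flow_initial t])
  ultimately show "closure \<Omega> \<subseteq> \<phi> t ` closure \<Omega>"
    by (rule closure_minimal[rotated])
qed

lemma flow_frontier_image:
  assumes t: "t \<in> {0..1}"
  shows "\<phi> t ` frontier \<Omega> = frontier \<Omega>"
proof
  show "\<phi> t ` frontier \<Omega> \<subseteq> frontier \<Omega>"
    using flow_frontier t by blast
  show "frontier \<Omega> \<subseteq> \<phi> t ` frontier \<Omega>"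
  proof
    fix p assume "p \<in> frontier \<Omega>"
    then have p: "p \<in> closure \<Omega>" "p \<notin> \<Omega>"
      using domain_open by (auto simp: frontier_def interior_open)
    then obtain z where z: "z \<in> closure \<Omega>" "p = \<phi> t z"
      using flow_closure_image[OF t] by blast
    then have "z \<notin> \<Omega>"
      using p(2) flow_interior t by blast
    with z show "p \<in> \<phi> t ` frontier \<Omega>"
      using closure_open_eq_Un_frontier[OF domain_open] by blast
  qed
qed

end

section \<open>Gradient images of strictly convex functions\<close>

lemma pos_def_derivative_strict_mono:
  fixes g :: "real^'m::finite \<Rightarrow> real^'m"
  assumes K: "convex K"
    and der: "\<And>z. z \<in> K \<Longrightarrow> (g has_derivative (\<lambda>v. A z *v v)) (at z)"
    and pos: "\<And>z. z \<in> K \<Longrightarrow> pos_def (A z)"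
    and xy: "x \<in> K" "y \<in> K" "x \<noteq> y"
  shows "(g x - g y) \<bullet> (x - y) > 0"
proof -
  have segment: "y + s *\<^sub>R (x - y) \<in> K" if "s \<in> {0..1}" for s
    using convexD_alt[OF K xy(2,1), of s] that by (simp add: algebra_simps)
  have der_segment: "((\<lambda>s. g (y + s *\<^sub>R (x - y)) \<bullet> (x - y)) has_derivative
      (\<lambda>v. v * ((A (y + s *\<^sub>R (x - y)) *v (x - y)) \<bullet> (x - y)))) (at s within {0..1})" if "s \<in> {0..1}" for s
  proof -
    have "((\<lambda>s. y + s *\<^sub>R (x - y)) has_derivative (\<lambda>v. v *\<^sub>R (x - y))) (at s within {0..1})"
      by (auto intro!: derivative_eq_intros)
    from has_derivative_inner_left[OF has_derivative_compose[OF this der[OF segment[OF that]]], of "x - y"]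
    show ?thesis
      by (simp add: matrix_vector_mult_scaleR)
  qed
  have "\<exists>s\<in>{0<..<1}. g (y + 1 *\<^sub>R (x - y)) \<bullet> (x - y) - g (y + 0 *\<^sub>R (x - y)) \<bullet> (x - y) =
      (1 - 0) * ((A (y + s *\<^sub>R (x - y)) *v (x - y)) \<bullet> (x - y))"
    by (rule mvt_simple) (use der_segment in auto)
  then obtain s where s: "s \<in> {0<..<1}" and
    mean_value: "(g x - g y) \<bullet> (x - y) = (A (y + s *\<^sub>R (x - y)) *v (x - y)) \<bullet> (x - y)"
    by (auto simp: inner_diff_left)
  have "pos_def (A (y + s *\<^sub>R (x - y)))"
    using s by (intro pos segment) auto
  then show ?thesis
    unfolding mean_value using xy by (simp add: pos_def_def inner_commute)
qed

corollary inj_on_pos_def_derivative: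
  fixes g :: "real^'m::finite \<Rightarrow> real^'m"
  assumes "convex K" "\<And>z. z \<in> K \<Longrightarrow> (g has_derivative (\<lambda>v. A z *v v)) (at z)" "\<And>z. z \<in> K \<Longrightarrow> pos_def (A z)"
  shows "inj_on g K"
proof (rule inj_onI, rule ccontr)
  fix x y assume "x \<in> K" "y \<in> K" "g x = g y" "x \<noteq> y"
  with pos_def_derivative_strict_mono[OF assms, of x y] show False by simp
qed

lemma has_derivative_nonneg_at_convex_minimum:
  fixes f :: "'a::real_normed_vector \<Rightarrow> real"
  assumes K: "convex K" "q \<in> K" "z \<in> K" and minimum: "\<And>z. z \<in> K \<Longrightarrow> f q \<le> f z"
    and f: "(f has_derivative f') (at q)"
  shows "f' (z - q) \<ge> 0"
proof (rule ccontr)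
  assume "\<not> f' (z - q) \<ge> 0"
  define k where "k = (\<lambda>s. f (q + s *\<^sub>R (z - q)))"
  have "((\<lambda>s. q + s *\<^sub>R (z - q)) has_derivative (\<lambda>v. v *\<^sub>R (z - q))) (at 0)"
    by (auto intro!: derivative_eq_intros)
  from has_derivative_compose[OF this, of f f'] f
  have "(k has_field_derivative f' (z - q)) (at 0)"
    by (simp add: k_def has_field_derivative_def linear_scale[OF has_derivative_linear[OF f]] mult_commute_abs)
  then obtain d where d: "d > 0" "\<And>h. 0 < h \<Longrightarrow> h < d \<Longrightarrow> k (0 + h) < k 0"
    using DERIV_neg_dec_right[of k "f' (z - q)" 0] \<open>\<not> f' (z - q) \<ge> 0\<close> by (metis not_le)
  define h where "h = min (d / 2) 1"
  have h: "0 < h" "h < d" "h \<le> 1"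
    using d(1) by (auto simp: h_def)
  have "q + h *\<^sub>R (z - q) \<in> K"
    using convexD_alt[OF K, of h] h by (simp add: algebra_simps)
  from minimum[OF this] d(2)[OF h(1,2)] show False
    by (simp add: k_def)
qed

lemma gradient_variational_inequality:
  fixes f :: "'a::real_inner \<Rightarrow> real"
  assumes K: "compact K" "convex K" "K \<noteq> {}"
    and f: "\<And>z. z \<in> K \<Longrightarrow> (f has_derivative (\<lambda>v. g z \<bullet> v)) (at z)"
  obtains q where "q \<in> K" "\<And>z. z \<in> K \<Longrightarrow> (g q - y) \<bullet> (z - q) \<ge> 0"
proof -
  have der: "((\<lambda>z. f z - y \<bullet> z) has_derivative (\<lambda>v. (g z - y) \<bullet> v)) (at z)" if "z \<in> K" for z
    using f[OF that] by (auto intro!: derivative_eq_intros simp: inner_diff_left)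
  then have "continuous_on K (\<lambda>z. f z - y \<bullet> z)"
    by (rule has_derivative_continuous_on[OF has_derivative_at_withinI])
  then obtain q where q: "q \<in> K" and minimum: "\<And>z. z \<in> K \<Longrightarrow> f q - y \<bullet> q \<le> f z - y \<bullet> z"
    using continuous_attains_inf[of K "\<lambda>z. f z - y \<bullet> z"] K by auto
  show thesis
    using that[OF q] has_derivative_nonneg_at_convex_minimum[OF K(2) q _ minimum der[OF q]] by blast
qed

lemma variational_inequality_interior:
  fixes w :: "'a::real_inner"
  assumes "open S" "q \<in> S" "\<And>z. z \<in> S \<Longrightarrow> w \<bullet> (z - q) \<ge> 0"
  shows "w = 0"
proof -
  have "((\<lambda>z. w \<bullet> z) has_derivative (\<lambda>v. w \<bullet> v)) (at q)"
    by (intro bounded_linear_imp_has_derivative bounded_linear_inner_right)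
  then have "(\<lambda>v. w \<bullet> v) = (\<lambda>v. 0)"
    using assms(3) by (intro differential_zero_maxmin[OF assms(2,1)]) (auto simp: inner_diff_right)
  from fun_cong[OF this, of w] show ?thesis
    by simp
qed

lemma gradient_image_iff_frontier:
  fixes f :: "real^'m::finite \<Rightarrow> real"
  assumes \<Omega>: "open \<Omega>" "bounded \<Omega>" "convex \<Omega>" "\<Omega> \<noteq> {}"
    and f: "\<And>z. z \<in> closure \<Omega> \<Longrightarrow> (f has_derivative (\<lambda>v. g z \<bullet> v)) (at z)"
    and g: "\<And>z. z \<in> closure \<Omega> \<Longrightarrow> (g has_derivative (\<lambda>v. A z *v v)) (at z)"
    and pos: "\<And>z. z \<in> closure \<Omega> \<Longrightarrow> pos_def (A z)"
  shows "y \<in> g ` \<Omega> \<longleftrightarrow> \<not> (\<exists>p\<in>frontier \<Omega>. \<forall>z\<in>closure \<Omega>. (g p - y) \<bullet> (z - p) \<ge> 0)"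
proof
  have closure: "compact (closure \<Omega>)" "convex (closure \<Omega>)" "closure \<Omega> \<noteq> {}"
    using \<Omega> by (simp_all add: convex_closure compact_closure)
  show "\<not> (\<exists>p\<in>frontier \<Omega>. \<forall>z\<in>closure \<Omega>. (g p - y) \<bullet> (z - p) \<ge> 0)" if "y \<in> g ` \<Omega>"
  proof -
    obtain q where q: "q \<in> \<Omega>" "y = g q"
      using \<open>y \<in> g ` \<Omega>\<close> by blast
    have "(g p - y) \<bullet> (q - p) < 0" if "p \<in> frontier \<Omega>" for p
    proof -
      have "p \<in> closure \<Omega>" "p \<noteq> q" "q \<in> closure \<Omega>"
        using that q \<Omega> closure_subset by (auto simp: frontier_def interior_open)
      then have "(g p - g q) \<bullet> (p - q) > 0"
        by (intro pos_def_derivative_strict_mono[OF closure(2) g pos])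
      then show ?thesis
        using inner_minus_right[of "g p - g q" "p - q"] q by simp
    qed
    with q closure_subset show ?thesis
      by (meson in_mono not_less)
  qed
  assume no_frontier_solution: "\<not> (\<exists>p\<in>frontier \<Omega>. \<forall>z\<in>closure \<Omega>. (g p - y) \<bullet> (z - p) \<ge> 0)"
  obtain q where q: "q \<in> closure \<Omega>" and solution: "\<And>z. z \<in> closure \<Omega> \<Longrightarrow> (g q - y) \<bullet> (z - q) \<ge> 0"
    using gradient_variational_inequality[OF closure f] by blast
  then have "q \<in> \<Omega>"
    using no_frontier_solution \<Omega>(1) by (auto simp: frontier_def interior_open)
  then have "g q - y = 0"
    using solution closure_subset by (intro variational_inequality_interior[OF \<Omega>(1)]) auto
  with \<open>q \<in> \<Omega>\<close> show "y \<in> g ` \<Omega>"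
    by force
qed

lemma pos_def_det_pos:
  fixes A :: "real^'m::finite^'m"
  assumes "pos_def A"
  shows "det A > 0"
proof -
  define B where "B s = (1 - s) *\<^sub>R mat 1 + s *\<^sub>R A" for s :: real
  have det_nonzero: "det (B s) \<noteq> 0" if "s \<in> {0..1}" for s
  proof
    assume "det (B s) = 0"
    then have "\<not> invertible (B s)"
      by (simp add: invertible_det_nz)
    then obtain v where v: "v \<noteq> 0" "B s *v v = 0"
      by (metis invertible_left_inverse matrix_left_invertible_ker)
    have "v \<bullet> (B s *v v) = (1 - s) * (v \<bullet> v) + s * (v \<bullet> (A *v v))"
      by (simp add: B_def matrix_vector_mult_add_rdistrib scaleR_matrix_vector_assoc[symmetric] inner_add_right)
    moreover have "v \<bullet> v > 0" "v \<bullet> (A *v v) > 0"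
      using v assms by (auto simp: pos_def_def)
    ultimately have "v \<bullet> (B s *v v) > 0"
      using that by (cases "s = 0") (auto intro!: add_nonneg_pos)
    with v show False by simp
  qed
  have "continuous_on {0..1} (\<lambda>s. det (B s))"
    unfolding B_def det_def by (intro continuous_intros)
  moreover have "det (B 0) = 1" "det (B 1) = det A"
    by (simp_all add: B_def)
  ultimately show ?thesis
    using IVT2'[of "\<lambda>s. det (B s)" 1 0 0] det_nonzero by (cases "det A \<le> 0") auto
qed

section \<open>Averages and Jensen's inequality for powers\<close>

definition average :: "'a::euclidean_space set \<Rightarrow> ('a \<Rightarrow> real) \<Rightarrow> real" where
  "average S f = integral S f / measure lebesgue S"

lemma integrable_on_continuous_closure:
  fixes f :: "'a::euclidean_space \<Rightarrow> 'b::euclidean_space"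
  assumes "S \<in> sets borel" "bounded S" "continuous_on (closure S) f"
  shows "f integrable_on S"
proof -
  have "set_integrable lborel (closure S) f"
    unfolding set_integrable_def using assms by (intro borel_integrable_compact) (simp_all add: compact_closure)
  then have "set_integrable lborel S f"
    by (rule set_integrable_subset) (simp_all add: assms(1) closure_subset)
  then show ?thesis
    by (rule set_borel_integral_eq_integral)
qed

lemma continuous_on_integral_family:
  fixes F :: "'t::metric_space \<Rightarrow> 'a::euclidean_space \<Rightarrow> 'b::euclidean_space"
  assumes S: "S \<in> sets borel" "bounded S" and T: "compact T"
    and F: "continuous_on (T \<times> closure S) (\<lambda>(t, z). F t z)"
  shows "continuous_on T (\<lambda>t. integral S (F t))"
  unfolding continuous_on_sequentially o_def
proof (intro allI ballI impI, elim conjE)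
  fix t and x :: "nat \<Rightarrow> 't" assume t: "t \<in> T" and x: "\<forall>n. x n \<in> T" "x \<longlonglongrightarrow> t"
  have "bounded ((\<lambda>(t, z). F t z) ` (T \<times> closure S))"
    using S(2) T F by (intro compact_imp_bounded compact_continuous_image compact_Times)
      (simp_all add: compact_closure)
  then obtain B where B: "\<And>t z. t \<in> T \<Longrightarrow> z \<in> closure S \<Longrightarrow> norm (F t z) \<le> B"
    unfolding bounded_iff by fastforce
  show "(\<lambda>n. integral S (F (x n))) \<longlonglongrightarrow> integral S (F t)"
  proof (rule dominated_convergence(2)[where h="\<lambda>_. B"])
    show "F (x n) integrable_on S" for n
      using x by (intro integrable_on_continuous_closure S continuous_on_slice[OF F]) auto
    show "(\<lambda>_. B) integrable_on S"
      by (intro integrable_on_continuous_closure S continuous_on_const)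
    fix z assume "z \<in> S"
    then have z: "z \<in> closure S"
      using closure_subset by blast
    show "norm (F (x n) z) \<le> B" for n
      using B x z by blast
    have "(\<lambda>n. (x n, z)) \<longlonglongrightarrow> (t, z)"
      using x(2) by (intro tendsto_Pair tendsto_const)
    from continuous_on_tendsto_compose[OF F this] x(1) t z
    show "(\<lambda>n. F (x n) z) \<longlonglongrightarrow> F t z"
      by simp
  qed
qed

lemma measure_lebesgue_open_pos:
  fixes S :: "'a::euclidean_space set"
  assumes "open S" "bounded S" "S \<noteq> {}"
  shows "measure lebesgue S > 0"
  using assms open_not_negligible[of S] lmeasurable_open[of S] negligible_iff_measure0[of S]
  by (metis measure_nonneg less_eq_real_def)

lemma average_affine:
  assumes S: "S \<in> lmeasurable" "measure lebesgue S > 0" and f: "f integrable_on S"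
  shows "average S (\<lambda>x. a + b * f x) = a + b * average S f"
proof -
  have "((\<lambda>x. a * 1 + b * f x) has_integral a * measure lebesgue S + b * integral S f) S"
    using S(1) f by (intro has_integral_add has_integral_mult_right integrable_integral)
      (simp add: has_integral_iff lmeasure_integral lmeasurable_iff_integrable_on)
  then show ?thesis
    using S(2) by (simp add: average_def integral_unique add_divide_distrib)
qed

lemma integral_eq_imp_eq_on_open:
  fixes f g :: "'a::euclidean_space \<Rightarrow> real"
  assumes S: "open S" and cont: "continuous_on S f" "continuous_on S g"
    and int: "f integrable_on S" "g integrable_on S" "integral S f = integral S g"
    and le: "\<And>x. x \<in> S \<Longrightarrow> f x \<le> g x" and x: "x \<in> S"
  shows "f x = g x"
proof -
  let ?gap = "\<lambda>x. g x - f x"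
  obtain a b where box: "x \<in> box a b" "cbox a b \<subseteq> S"
    using open_contains_cbox[OF S x] by metis
  have cont_gap: "continuous_on (cbox a b) ?gap"
    using cont box(2) by (intro continuous_on_diff) (auto intro: continuous_on_subset)
  then have int_gap: "?gap integrable_on cbox a b"
    by (rule integrable_continuous)
  have "integral (cbox a b) ?gap \<le> integral S ?gap"
    using box(2) int_gap integrable_diff[OF int(2,1)] le by (intro integral_subset_le) auto
  moreover have "integral S ?gap = 0"
    using int by (simp add: integral_diff)
  moreover have "integral (cbox a b) ?gap \<ge> 0"
    using int_gap le box(2) by (intro integral_nonneg) auto
  ultimately have "(?gap has_integral 0) (cbox a b)"
    using int_gap by (simp add: has_integral_iff)
  then have "?gap x = 0"
    using box le box_subset_cbox[of a b] by (intro has_integral_0_cbox_imp_0[OF cont_gap]) auto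
  then show ?thesis by simp
qed

lemma average_pos:
  assumes S: "open S" "bounded S" "S \<noteq> {}"
    and f: "continuous_on (closure S) f" "\<And>x. x \<in> closure S \<Longrightarrow> 0 < f x"
  shows "average S f > 0"
proof -
  have pos: "f x > 0" if "x \<in> S" for x
    using f(2) closure_subset that by blast
  have integrable: "f integrable_on S"
    by (rule integrable_on_continuous_closure[OF borel_open[OF S(1)] S(2) f(1)])
  have "integral S f \<noteq> 0"
  proof
    assume zero: "integral S f = 0"
    obtain x where x: "x \<in> S" using S(3) by blast
    have "0 = f x"
      by (rule integral_eq_imp_eq_on_open[OF S(1) continuous_on_const
            continuous_on_subset[OF f(1) closure_subset] integrable_0 integrable])
        (use pos x zero in \<open>auto simp: less_imp_le\<close>)
    with pos[OF x] show False by simp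
  qed
  moreover have "integral S f \<ge> 0"
    using pos by (intro integral_nonneg integrable) (simp add: less_imp_le)
  ultimately show ?thesis
    using measure_lebesgue_open_pos[OF S] by (simp only: average_def) simp
qed

text \<open>Young's inequality for \<open>sqrt x\<close>, squared, leaves the remainder that settles the equality case.\<close>

lemma powr_tangent_gap_ge:
  fixes x :: real
  assumes \<alpha>: "0 < \<alpha>" "\<alpha> < 1" and x: "x > 0"
  shows "\<alpha> * (1 - \<alpha>) * (sqrt x - 1)\<^sup>2 \<le> 1 + \<alpha> * (x - 1) - x powr \<alpha>"
proof -
  define s where "s = sqrt x"
  have s: "s > 0" "x = s\<^sup>2"
    using x by (simp_all add: s_def)
  have "s powr \<alpha> \<le> 1 + \<alpha> * (s - 1)"
    using Youngs_inequality_0[of \<alpha> "1 - \<alpha>" s 1] \<alpha> s by (simp add: algebra_simps)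
  then have "(s powr \<alpha>)\<^sup>2 \<le> (1 + \<alpha> * (s - 1))\<^sup>2"
    by (intro power_mono) auto
  moreover have "x powr \<alpha> = (s powr \<alpha>)\<^sup>2"
    using s by (simp add: power2_eq_square powr_mult)
  ultimately show ?thesis
    unfolding s_def[symmetric] by (simp add: s(2) power2_eq_square algebra_simps)
qed

lemma powr_le_tangent:
  fixes A x :: real
  assumes \<alpha>: "0 < \<alpha>" "\<alpha> < 1" and A: "A > 0" and x: "x > 0"
  defines "tangent \<equiv> A powr \<alpha> * (1 - \<alpha>) + A powr \<alpha> * \<alpha> / A * x"
  shows "x powr \<alpha> \<le> tangent" and "x powr \<alpha> = tangent \<Longrightarrow> x = A"
proof -
  have "tangent - x powr \<alpha> = A powr \<alpha> * (1 + \<alpha> * (x / A - 1) - (x / A) powr \<alpha>)"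
    using A x by (simp add: tangent_def powr_divide field_simps)
  moreover have "A powr \<alpha> * (\<alpha> * (1 - \<alpha>) * (sqrt (x / A) - 1)\<^sup>2) \<le> \<dots>"
    using powr_tangent_gap_ge[OF \<alpha>, of "x / A"] A x by (intro mult_left_mono) auto
  moreover define \<kappa> where "\<kappa> = A powr \<alpha> * (\<alpha> * (1 - \<alpha>))"
  ultimately have gap: "\<kappa> * (sqrt (x / A) - 1)\<^sup>2 \<le> tangent - x powr \<alpha>"
    by (simp add: mult.assoc)
  have "\<kappa> > 0"
    using \<alpha> A by (simp add: \<kappa>_def)
  then have "\<kappa> * (sqrt (x / A) - 1)\<^sup>2 \<ge> 0"
    by simp
  with gap show "x powr \<alpha> \<le> tangent"
    by linarith
  assume "x powr \<alpha> = tangent"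
  with gap \<open>\<kappa> > 0\<close> have "(sqrt (x / A) - 1)\<^sup>2 \<le> 0"
    by (simp add: mult_le_0_iff)
  then have "sqrt (x / A) = 1"
    by simp
  then show "x = A"
    using A by simp
qed

context
  fixes S :: "'a::euclidean_space set" and f :: "'a \<Rightarrow> real" and \<alpha> :: real
  assumes S: "open S" "bounded S" "S \<noteq> {}"
    and f: "continuous_on (closure S) f" "\<And>x. x \<in> closure S \<Longrightarrow> 0 < f x"
    and \<alpha>: "0 < \<alpha>" "\<alpha> < 1"
begin

private lemma S_measure: "S \<in> lmeasurable" "measure lebesgue S > 0"
  by (rule lmeasurable_open[OF S(2,1)]) (rule measure_lebesgue_open_pos[OF S])

private lemma S_integrable: "continuous_on (closure S) h \<Longrightarrow> h integrable_on S" for h :: "'a \<Rightarrow> real"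
  using S by (intro integrable_on_continuous_closure) auto

private definition tangent :: "real \<Rightarrow> real" where
  "tangent y = average S f powr \<alpha> * (1 - \<alpha>) + average S f powr \<alpha> * \<alpha> / average S f * y"

private lemma powr_le_tangent_average:
  assumes "x \<in> closure S"
  shows "f x powr \<alpha> \<le> tangent (f x)" and "f x powr \<alpha> = tangent (f x) \<Longrightarrow> f x = average S f"
  using powr_le_tangent[OF \<alpha> average_pos[OF S f] f(2)[OF assms]] by (simp_all add: tangent_def)

private lemma average_tangent: "average S (\<lambda>x. tangent (f x)) = average S f powr \<alpha>"
proof -
  have "average S (\<lambda>x. tangent (f x)) = tangent (average S f)"
    unfolding tangent_def by (rule average_affine[OF S_measure S_integrable[OF f(1)]])
  also have "\<dots> = average S f powr \<alpha>"
    using average_pos[OF S f] by (simp add: tangent_def algebra_simps)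
  finally show ?thesis .
qed

private lemma continuous_powr_tangent:
  "continuous_on (closure S) (\<lambda>x. f x powr \<alpha>)" "continuous_on (closure S) (\<lambda>x. tangent (f x))"
  unfolding tangent_def using f average_pos[OF S f]
  by (auto intro!: continuous_intros simp: less_imp_neq[THEN not_sym])

lemma average_powr_le: "average S (\<lambda>x. f x powr \<alpha>) \<le> average S f powr \<alpha>"
proof -
  have "integral S (\<lambda>x. f x powr \<alpha>) \<le> integral S (\<lambda>x. tangent (f x))"
    using powr_le_tangent_average(1) closure_subset
    by (intro integral_le S_integrable continuous_powr_tangent) blast
  then show ?thesis
    unfolding average_tangent[symmetric] using S_measure by (simp add: average_def divide_right_mono)
qed

lemma average_powr_eq_iff:
  "average S (\<lambda>x. f x powr \<alpha>) = average S f powr \<alpha> \<longleftrightarrow> (\<forall>x\<in>S. f x = average S f)"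
proof
  assume "average S (\<lambda>x. f x powr \<alpha>) = average S f powr \<alpha>"
  then have "integral S (\<lambda>x. f x powr \<alpha>) = integral S (\<lambda>x. tangent (f x))"
    unfolding average_tangent[symmetric] using S_measure by (simp add: average_def)
  then have "f x powr \<alpha> = tangent (f x)" if "x \<in> S" for x
    using that powr_le_tangent_average(1) closure_subset[of S]
      S_integrable[OF continuous_powr_tangent(1)] S_integrable[OF continuous_powr_tangent(2)]
      continuous_on_subset[OF continuous_powr_tangent(1)] continuous_on_subset[OF continuous_powr_tangent(2)]
    by (intro integral_eq_imp_eq_on_open[OF S(1), of "\<lambda>x. f x powr \<alpha>" "\<lambda>x. tangent (f x)"]) auto
  then show "\<forall>x\<in>S. f x = average S f"
    using powr_le_tangent_average(2) closure_subset by blast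
next
  assume "\<forall>x\<in>S. f x = average S f"
  then have "average S (\<lambda>x. f x powr \<alpha>) = average S (\<lambda>x. average S f powr \<alpha> + 0 * f x)"
    unfolding average_def by (intro arg_cong2[where f="(/)"] integral_cong) auto
  then show "average S (\<lambda>x. f x powr \<alpha>) = average S f powr \<alpha>"
    using average_affine[OF S_measure S_integrable[OF f(1)], of _ 0] by simp
qed

end

section \<open>Comparison of length and volume\<close>

definition generator_length :: "(real^'m::finite) set \<Rightarrow> (real \<Rightarrow> real^'m \<Rightarrow> real) \<Rightarrow> real" where
  "generator_length \<Omega> H = (1 / measure lebesgue \<Omega>) *
     integral {0..1} (\<lambda>t. integral \<Omega> (\<lambda>z. det (hess (H t) z) powr (1 / real CARD('m))))"

definition generator_volume :: "(real^'m::finite) set \<Rightarrow> (real \<Rightarrow> real^'m \<Rightarrow> real) \<Rightarrow> real" where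
  "generator_volume \<Omega> H = measure lebesgue \<Omega> powr (- 1 / real CARD('m)) *
     integral {0..1} (\<lambda>t. measure lebesgue (grad (H t) ` \<Omega>) powr (1 / real CARD('m)))"

context hamiltonian_path
begin

lemma domain_measure: "\<Omega> \<in> lmeasurable" "measure lebesgue \<Omega> > 0"
  by (rule lmeasurable_open[OF domain_bounded domain_open])
    (rule measure_lebesgue_open_pos[OF domain_open domain_bounded nonempty])

lemma det_hess_pos: "t \<in> {0..1} \<Longrightarrow> z \<in> closure \<Omega> \<Longrightarrow> det (hess (H t) z) > 0"
  by (rule pos_def_det_pos[OF pos_def_hess])

lemma continuous_on_det_hess: "continuous_on ({0..1} \<times> closure \<Omega>) (\<lambda>(t, z). det (hess (H t) z))"
proof -
  have "continuous_on ({0..1} \<times> closure \<Omega>) (\<lambda>p. det ((\<lambda>(t, z). hess (H t) z) p))"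
    unfolding det_def by (intro continuous_intros continuous_on_hess)
  then show ?thesis by (simp add: case_prod_beta')
qed

lemma continuous_on_det_hess_powr:
  "continuous_on ({0..1} \<times> closure \<Omega>) (\<lambda>(t, z). det (hess (H t) z) powr a)"
proof -
  have "continuous_on ({0..1} \<times> closure \<Omega>) (\<lambda>p. (\<lambda>(t, z). det (hess (H t) z)) p powr a)"
    using det_hess_pos by (intro continuous_on_powr continuous_on_det_hess continuous_on_const)
      (force dest: less_imp_neq)
  then show ?thesis by (simp add: case_prod_beta')
qed

lemma measure_grad_image:
  assumes t: "t \<in> {0..1}"
  shows "measure lebesgue (grad (H t) ` \<Omega>) = integral \<Omega> (\<lambda>z. det (hess (H t) z))"
proof -
  have abs_det: "\<bar>det (matrix (\<lambda>v. hess (H t) z *v v))\<bar> = det (hess (H t) z)" if "z \<in> \<Omega>" for z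
    using det_hess_pos[OF t, of z] that closure_subset[of \<Omega>] by auto
  have "(\<lambda>z. det (hess (H t) z)) integrable_on \<Omega>"
    using domain_open domain_bounded t
    by (intro integrable_on_continuous_closure continuous_on_slice[OF continuous_on_det_hess]) auto
  then have integrable: "(\<lambda>z. \<bar>det (matrix (\<lambda>v. hess (H t) z *v v))\<bar>) integrable_on \<Omega>"
    using abs_det by (metis (mono_tags, lifting) integrable_cong)
  have "inj_on (grad (H t)) (closure \<Omega>)"
    using t by (intro inj_on_pos_def_derivative[where A="hess (H t)"] closure_domain_convex
        has_derivative_generator(2) pos_def_hess)
  then have injective: "inj_on (grad (H t)) \<Omega>"
    using closure_subset by (rule inj_on_subset)
  have "CARD('n bit0) = CARD('n + 'n)" \<comment> \<open>\<open>'n bit0\<close> is a well-ordered type\<close>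
    by simp
  then obtain e :: "'n bit0 \<Rightarrow> 'n + 'n" where "bij e"
    using finite_same_card_bij[of "UNIV :: 'n bit0 set" "UNIV :: ('n + 'n) set"] by auto
  then have "measure lebesgue (grad (H t) ` \<Omega>) = integral \<Omega> (\<lambda>z. \<bar>det (matrix (\<lambda>v. hess (H t) z *v v))\<bar>)"
    using domain_open has_derivative_generator(2)[OF t] injective integrable closure_subset
    by (intro measure_differentiable_image_eq_reindex) blast+
  also have "\<dots> = integral \<Omega> (\<lambda>z. det (hess (H t) z))"
    using abs_det by (rule integral_cong)
  finally show ?thesis .
qed

definition mean_det :: "real \<Rightarrow> real" where
  "mean_det t = average \<Omega> (\<lambda>z. det (hess (H t) z))"

definition mean_det_root :: "real \<Rightarrow> real" where
  "mean_det_root t = average \<Omega> (\<lambda>z. det (hess (H t) z) powr (1 / real CARD('n + 'n)))"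

lemma mean_det_pos: "t \<in> {0..1} \<Longrightarrow> mean_det t > 0"
  unfolding mean_det_def
  by (intro average_pos domain_open domain_bounded nonempty continuous_on_slice[OF continuous_on_det_hess]
      det_hess_pos)

lemma continuous_on_mean_det: "continuous_on {0..1} mean_det"
  and continuous_on_mean_det_root: "continuous_on {0..1} mean_det_root"
proof -
  note integral_continuous = continuous_on_integral_family[OF borel_open[OF domain_open] domain_bounded
      compact_Icc]
  note measure_nonzero = less_imp_neq[OF domain_measure(2), THEN not_sym]
  show "continuous_on {0..1} mean_det" "continuous_on {0..1} mean_det_root"
    unfolding mean_det_def[abs_def] mean_det_root_def[abs_def] average_def
    by (intro continuous_on_divide continuous_on_const integral_continuous continuous_on_det_hess
        continuous_on_det_hess_powr ballI measure_nonzero)+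
qed

lemma continuous_on_mean_det_powr: "continuous_on {0..1} (\<lambda>t. mean_det t powr a)"
  using mean_det_pos by (intro continuous_on_powr continuous_on_mean_det continuous_on_const)
    (auto simp: less_imp_neq[THEN not_sym])

lemma generator_length_eq_integral: "generator_length \<Omega> H = integral {0..1} mean_det_root"
  unfolding generator_length_def mean_det_root_def[abs_def] average_def
  by (subst integral_mult_right[symmetric]) simp

lemma generator_volume_eq_integral:
  "generator_volume \<Omega> H = integral {0..1} (\<lambda>t. mean_det t powr (1 / real CARD('n + 'n)))"
  unfolding generator_volume_def integral_mult_right[symmetric]
proof (rule integral_cong)
  fix t :: real assume t: "t \<in> {0..1}"
  show "measure lebesgue \<Omega> powr (- 1 / real CARD('n + 'n)) *
      measure lebesgue (grad (H t) ` \<Omega>) powr (1 / real CARD('n + 'n)) =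
      mean_det t powr (1 / real CARD('n + 'n))"
    unfolding mean_det_def average_def measure_grad_image[OF t, symmetric] using domain_measure(2)
    by (simp add: powr_divide powr_minus_divide)
qed

lemma mean_det_root_le: "t \<in> {0..1} \<Longrightarrow> mean_det_root t \<le> mean_det t powr (1 / real CARD('n + 'n))"
  and mean_det_root_eq_iff: "t \<in> {0..1} \<Longrightarrow> mean_det_root t = mean_det t powr (1 / real CARD('n + 'n)) \<longleftrightarrow>
    (\<forall>z\<in>\<Omega>. det (hess (H t) z) = mean_det t)"
proof -
  assume t: "t \<in> {0..1}"
  have "real CARD('n) \<ge> 1" "real CARD('n + 'n) = 2 * real CARD('n)"
    using zero_less_card_finite[where 'a='n] by linarith (simp_all add: card_UNIV_sum)
  then have "real CARD('n + 'n) > 1"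
    by linarith
  then have exponent: "0 < 1 / real CARD('n + 'n)" "1 / real CARD('n + 'n) < 1"
    by (simp_all only: divide_less_eq_1_pos zero_less_divide_1_iff)
  note jensen_hypotheses = domain_open domain_bounded nonempty
    continuous_on_slice[OF continuous_on_det_hess t] det_hess_pos[OF t] exponent
  show "mean_det_root t \<le> mean_det t powr (1 / real CARD('n + 'n))"
    unfolding mean_det_def mean_det_root_def by (rule average_powr_le[OF jensen_hypotheses])
  show "mean_det_root t = mean_det t powr (1 / real CARD('n + 'n)) \<longleftrightarrow>
      (\<forall>z\<in>\<Omega>. det (hess (H t) z) = mean_det t)"
    unfolding mean_det_def mean_det_root_def by (rule average_powr_eq_iff[OF jensen_hypotheses])
qed

lemma det_hess_eq_mean_det_iff:
  assumes t: "t \<in> {0..1}"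
  shows "(\<forall>z\<in>\<Omega>. det (hess (H t) z) = mean_det t) \<longleftrightarrow> (\<exists>c>0. \<forall>z\<in>closure \<Omega>. det (hess (H t) z) = c)"
proof
  assume "\<forall>z\<in>\<Omega>. det (hess (H t) z) = mean_det t"
  then have "det (hess (H t) z) = mean_det t" if "z \<in> closure \<Omega>" for z
    using continuous_constant_on_closure[OF continuous_on_slice[OF continuous_on_det_hess t] _ that] by blast
  then show "\<exists>c>0. \<forall>z\<in>closure \<Omega>. det (hess (H t) z) = c"
    using mean_det_pos[OF t] by blast
next
  assume "\<exists>c>0. \<forall>z\<in>closure \<Omega>. det (hess (H t) z) = c"
  then obtain c where c: "\<And>z. z \<in> \<Omega> \<Longrightarrow> det (hess (H t) z) = c"
    using closure_subset by blast
  have "mean_det t = average \<Omega> (\<lambda>z. c + 0 * 0)"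
    unfolding mean_det_def average_def using c by (intro arg_cong2[where f="(/)"] integral_cong) auto
  also have "\<dots> = c"
    using average_affine[OF domain_measure integrable_0, of c 0] by simp
  finally show "\<forall>z\<in>\<Omega>. det (hess (H t) z) = mean_det t"
    using c by simp
qed

theorem generator_length_le_volume: "generator_length \<Omega> H \<le> generator_volume \<Omega> H"
  unfolding generator_length_eq_integral generator_volume_eq_integral
  by (intro integral_le integrable_continuous_interval continuous_on_mean_det_root continuous_on_mean_det_powr
      mean_det_root_le)

theorem generator_length_eq_volume_iff:
  "generator_length \<Omega> H = generator_volume \<Omega> H \<longleftrightarrow>
     (\<exists>c. \<forall>t\<in>{0..1}. c t > 0 \<and> (\<forall>z\<in>closure \<Omega>. det (hess (H t) z) = c t))"
proof -
  let ?gap = "\<lambda>t. mean_det t powr (1 / real CARD('n + 'n)) - mean_det_root t"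
  have "generator_volume \<Omega> H - generator_length \<Omega> H = integral {0..1} ?gap"
    unfolding generator_length_eq_integral generator_volume_eq_integral
    by (intro integral_diff[symmetric] integrable_continuous_interval continuous_on_mean_det_root
        continuous_on_mean_det_powr)
  moreover have "integral {0..1} ?gap = 0 \<longleftrightarrow> (\<forall>t\<in>{0..1}. ?gap t = 0)"
    using mean_det_root_le
    by (intro integral_eq_0_iff continuous_on_diff continuous_on_mean_det_root continuous_on_mean_det_powr) auto
  ultimately have "generator_length \<Omega> H = generator_volume \<Omega> H \<longleftrightarrow>
      (\<forall>t\<in>{0..1}. mean_det_root t = mean_det t powr (1 / real CARD('n + 'n)))"
    by (smt (verit))
  also have "\<dots> \<longleftrightarrow> (\<forall>t\<in>{0..1}. \<exists>c>0. \<forall>z\<in>closure \<Omega>. det (hess (H t) z) = c)"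
    using mean_det_root_eq_iff det_hess_eq_mean_det_iff by (intro ball_cong refl) blast
  finally show ?thesis
    by (simp add: bchoice_iff)
qed

end

section \<open>Independence of the generator\<close>

lemma generators_agree_along_flow:
  assumes H: "hamiltonian_path \<Omega> \<phi> H" and H': "hamiltonian_path \<Omega> \<phi>' H'"
    and z: "z \<in> closure \<Omega>" and same_orbit: "\<And>s. s \<in> {0..1} \<Longrightarrow> \<phi> s z = \<phi>' s z" and t: "t \<in> {0..1}"
  shows "grad (H t) (\<phi> t z) = grad (H' t) (\<phi> t z)"
proof -
  have "((\<lambda>s. \<phi> s z) has_vector_derivative J0 (grad (H' t) (\<phi>' t z))) (at t within {0..1})"
    by (rule has_vector_derivative_transform[OF t same_orbit hamiltonian_path.flow_derivative[OF H' t z]])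
  moreover have "at t within {0..1} \<noteq> bot"
    using t by (cases "t = 1") (auto simp: trivial_limit_within islimpt_Icc)
  ultimately have "J0 (grad (H t) (\<phi> t z)) = J0 (grad (H' t) (\<phi>' t z))"
    using vector_derivative_unique_within hamiltonian_path.flow_derivative[OF H t z] by blast
  then show ?thesis
    using inj_J0 same_orbit[OF t] by (metis injD)
qed

lemma grad_generator_eq_on_image:
  assumes H: "hamiltonian_path \<Omega> \<phi> H" and H': "hamiltonian_path \<Omega> \<phi>' H'"
    and "S \<subseteq> closure \<Omega>" and "\<And>s z. s \<in> {0..1} \<Longrightarrow> z \<in> S \<Longrightarrow> \<phi> s z = \<phi>' s z"
    and "t \<in> {0..1}" "p \<in> \<phi> t ` S"
  shows "grad (H t) p = grad (H' t) p"
  using assms generators_agree_along_flow[OF H H'] by blast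

lemma grad_image_eq_of_frontier_eq:
  assumes H: "hamiltonian_path \<Omega> \<phi> H" and H': "hamiltonian_path \<Omega> \<phi>' H'"
    and same_frontier: "\<And>s z. s \<in> {0..1} \<Longrightarrow> z \<in> frontier \<Omega> \<Longrightarrow> \<phi> s z = \<phi>' s z" and t: "t \<in> {0..1}"
  shows "grad (H t) ` \<Omega> = grad (H' t) ` \<Omega>"
proof (rule set_eqI)
  interpret H: hamiltonian_path \<Omega> \<phi> H by (rule H)
  interpret H': hamiltonian_path \<Omega> \<phi>' H' by (rule H')
  note characterization = gradient_image_iff_frontier[OF H.domain_open H.domain_bounded H.domain_convex
      H.nonempty]
  have "frontier \<Omega> \<subseteq> closure \<Omega>"
    by (simp add: frontier_def)
  then have grad_frontier: "grad (H t) p = grad (H' t) p" if "p \<in> frontier \<Omega>" for p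
    using that by (intro grad_generator_eq_on_image[OF H H' _ same_frontier t, of "frontier \<Omega>"])
      (simp_all add: H.flow_frontier_image[OF t])
  fix y
  have "y \<in> grad (H t) ` \<Omega> \<longleftrightarrow> \<not> (\<exists>p\<in>frontier \<Omega>. \<forall>z\<in>closure \<Omega>. (grad (H t) p - y) \<bullet> (z - p) \<ge> 0)"
    by (rule characterization[OF H.has_derivative_generator[OF t] H.pos_def_hess[OF t]])
  also have "\<dots> \<longleftrightarrow> \<not> (\<exists>p\<in>frontier \<Omega>. \<forall>z\<in>closure \<Omega>. (grad (H' t) p - y) \<bullet> (z - p) \<ge> 0)"
    using grad_frontier by simp
  also have "\<dots> \<longleftrightarrow> y \<in> grad (H' t) ` \<Omega>"
    by (rule characterization[OF H'.has_derivative_generator[OF t] H'.pos_def_hess[OF t], symmetric])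
  finally show "y \<in> grad (H t) ` \<Omega> \<longleftrightarrow> y \<in> grad (H' t) ` \<Omega>" .
qed

lemma hess_generator_unique:
  assumes H: "hamiltonian_path \<Omega> \<phi> H" and H': "hamiltonian_path \<Omega> \<phi> H'" and t: "t \<in> {0..1}" and z: "z \<in> \<Omega>"
  shows "hess (H t) z = hess (H' t) z"
proof -
  interpret H: hamiltonian_path \<Omega> \<phi> H by (rule H)
  have grad: "grad (H t) p = grad (H' t) p" if "p \<in> \<Omega>" for p
    using grad_generator_eq_on_image[OF H H' subset_refl refl t] that closure_subset[of \<Omega>]
    by (auto simp: H.flow_closure_image[OF t])
  have "(grad (H t) has_derivative (\<lambda>v. hess (H t) z *v v)) (at z)"
    using H.has_derivative_generator(2)[OF t] z closure_subset by blast
  then have "(grad (H' t) has_derivative (\<lambda>v. hess (H t) z *v v)) (at z)"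
    by (rule has_derivative_transform_within_open[OF _ H.domain_open z grad])
  from frechet_derivative_at[OF this, symmetric] show ?thesis
    by (simp add: hess_def[of "H' t"])
qed

lemma lengthG_eq_generator_length:
  assumes H: "hamiltonian_path \<Omega> \<phi> H"
  shows "lengthG \<Omega> \<phi> = generator_length \<Omega> H"
proof -
  define H' where "H' = (SOME H'. positive_path \<Omega> \<phi> H')"
  have "\<exists>H. positive_path \<Omega> \<phi> H"
    using hamiltonian_path.positive[OF H] by blast
  then have "positive_path \<Omega> \<phi> H'"
    unfolding H'_def by (rule someI_ex)
  with H have H': "hamiltonian_path \<Omega> \<phi> H'"
    by (simp add: hamiltonian_path_def)
  have "lengthG \<Omega> \<phi> = generator_length \<Omega> H'"
    by (simp add: lengthG_def generator_length_def H'_def)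
  also have "\<dots> = generator_length \<Omega> H"
    unfolding generator_length_def using hess_generator_unique[OF H H']
    by (intro arg_cong2[where f="(*)"] refl integral_cong) simp
  finally show ?thesis .
qed

lemma volV_eq_generator_volume:
  assumes H: "hamiltonian_path \<Omega> \<phi> H" and extends: "extends_path \<Omega> \<phi> \<psi>"
  shows "volV \<Omega> \<psi> = generator_volume \<Omega> H"
proof -
  define H' where "H' = (SOME H'. \<exists>\<phi>'. positive_path \<Omega> \<phi>' H' \<and> extends_path \<Omega> \<phi>' \<psi>)"
  have "\<exists>H \<phi>'. positive_path \<Omega> \<phi>' H \<and> extends_path \<Omega> \<phi>' \<psi>"
    using hamiltonian_path.positive[OF H] extends by blast
  then have "\<exists>\<phi>'. positive_path \<Omega> \<phi>' H' \<and> extends_path \<Omega> \<phi>' \<psi>"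
    unfolding H'_def by (rule someI_ex)
  then obtain \<phi>' where \<phi>': "positive_path \<Omega> \<phi>' H'" "extends_path \<Omega> \<phi>' \<psi>" by blast
  with H have H': "hamiltonian_path \<Omega> \<phi>' H'"
    by (simp add: hamiltonian_path_def)
  have "grad (H t) ` \<Omega> = grad (H' t) ` \<Omega>" if "t \<in> {0..1}" for t
    using extends \<phi>'(2) that unfolding extends_path_def
    by (intro grad_image_eq_of_frontier_eq[OF H H']) auto
  then have "generator_volume \<Omega> H' = generator_volume \<Omega> H"
    unfolding generator_volume_def by (intro arg_cong2[where f="(*)"] refl integral_cong) simp
  moreover have "volV \<Omega> \<psi> = generator_volume \<Omega> H'"
    by (simp add: volV_def generator_volume_def H'_def)
  ultimately show ?thesis by simp
qed

theorem theorem9: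
  fixes \<Omega> :: "(real^('n::finite + 'n)) set"
    and \<psi> \<phi> :: "real \<Rightarrow> real^('n + 'n) \<Rightarrow> real^('n + 'n)"
  assumes "unif_convex_domain \<Omega>"
    and "extendable \<Omega> \<psi>"
    and "\<exists>H. positive_path \<Omega> \<phi> H"
    and "extends_path \<Omega> \<phi> \<psi>"
  shows "lengthG \<Omega> \<phi> \<le> volV \<Omega> \<psi> \<and>
         (lengthG \<Omega> \<phi> = volV \<Omega> \<psi> \<longleftrightarrow>
           (\<exists>H c. positive_path \<Omega> \<phi> H \<and>
              (\<forall>t\<in>{0..1}. c t > (0::real) \<and> (\<forall>z\<in>closure \<Omega>. det (hess (H t) z) = c t))))"
proof (cases "\<Omega> = {}")
  case True
  then have "lengthG \<Omega> \<phi> = volV \<Omega> \<psi>"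
    by (simp add: lengthG_def volV_def)
  with True assms(3) show ?thesis
    by (auto intro!: exI[of _ "\<lambda>_. 1"])
next
  case False
  have "lengthG \<Omega> \<phi> = generator_length \<Omega> H" "volV \<Omega> \<psi> = generator_volume \<Omega> H"
    "hamiltonian_path \<Omega> \<phi> H" if "positive_path \<Omega> \<phi> H" for H
  proof -
    show path: "hamiltonian_path \<Omega> \<phi> H"
      using assms(1) False that by unfold_locales
    show "lengthG \<Omega> \<phi> = generator_length \<Omega> H" "volV \<Omega> \<psi> = generator_volume \<Omega> H"
      using lengthG_eq_generator_length[OF path] volV_eq_generator_volume[OF path assms(4)] .
  qed
  then show ?thesis
    using assms(3) hamiltonian_path.generator_length_le_volume hamiltonian_path.generator_length_eq_volume_iff
    by metis
qed

end
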